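(* Let $(\mathscr{D}_n,\leq)$ be the poset of Dyck paths of size $n$ with the dexter order. The number of intervals in $\mathscr{D}_n$, i.e. the number of pairs $(u,v)\in\mathscr{D}_n\times\mathscr{D}_n$ with $u\leq v$, is $1$ for $n=0$ and is $$3\,\frac{2^{n-1}(2n)!}{n!\,(n+2)!}\qquad\text{for every } n\geq 1.$$
   Context: A Dyck path of size $n\geq 0$ is a word of length $2n$ in the letters $0,1$ with $n$ letters $1$ and $n$ letters $0$ such that every prefix contains at least as many $1$'s as $0$'s (the height after a prefix is its number of $1$'s minus its number of $0$'s). Let $\mathscr{D}_n$ be the set of Dyck paths of size $n$. A subpath of a Dyck path $w$ is a non-empty sequence $x$ of consecutive letters of $w$ that starts and ends at the same height and stays strictly above that height in between. A subpath $x$ is movable in $w$ if it is immediately preceded in $w$ by the letter $0$ and either $x$ ends at the last letter of $w$ or $x$ is immediately followed in $w$ by the letter $1$. For a movable subpath $x$, let $N=N(w,x)\geq 1$ be the number of consecutive letters $0$ just before $x$, so $w=a\,0^{N}\,x\,b$ where $a$ does not end with $0$; for $1\leq i\leq N$ let $M(w,x,i)=a\,0^{N-i}\,x\,0^{i}\,b\in\mathscr{D}_n$. Let $\Gamma_n$ be the directed graph on $\mathscr{D}_n$ with edges $w\to M(w,x,i)$ for all movable $x$ in $w$ and all $1\leq i\leq N(w,x)$. The dexter order is: $u\leq v$ if and only if there is a directed path (possibly of length $0$) from $u$ to $v$ in $\Gamma_n$. This is a partial order whose cover relations are exactly the edges of $\Gamma_n$. *)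

theory Defs
  imports Complex_Main
begin

text \<open>Words are lists of booleans: \<open>True\<close> stands for the letter 1, \<open>False\<close> for the letter 0.\<close>

definition height :: "bool list \<Rightarrow> int" where
  "height p = int (count_list p True) - int (count_list p False)"

definition dyck :: "nat \<Rightarrow> bool list set" where
  "dyck n = {w. length w = 2 * n \<and> count_list w True = n \<and> count_list w False = n \<and>
     (\<forall>k \<le> length w. count_list (take k w) False \<le> count_list (take k w) True)}"

text \<open>A subpath is an occurrence, not just a factor: it is recorded as a triple \<open>p\<close>, \<open>x\<close>, \<open>s\<close>
  with \<open>w = p @ x @ s\<close>.\<close>

definition is_subpath :: "bool list \<Rightarrow> bool list \<Rightarrow> bool list \<Rightarrow> bool list \<Rightarrow> bool" where
  "is_subpath w p x s \<longleftrightarrow> w = p @ x @ s \<and> x \<noteq> [] \<and> height (p @ x) = height p \<and>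
     (\<forall>k. 0 < k \<and> k < length x \<longrightarrow> height (p @ take k x) > height p)"

definition movable :: "bool list \<Rightarrow> bool list \<Rightarrow> bool list \<Rightarrow> bool list \<Rightarrow> bool" where
  "movable w p x s \<longleftrightarrow> is_subpath w p x s \<and> p \<noteq> [] \<and> last p = False \<and>
     (s = [] \<or> hd s = True)"

definition zeros_before :: "bool list \<Rightarrow> nat" where
  "zeros_before p = length (takeWhile (\<lambda>c. c = False) (rev p))"

text \<open>With \<open>N = zeros_before p\<close> and \<open>p = a @ replicate N False\<close>, the word below is
  \<open>a @ replicate (N - i) False @ x @ replicate i False @ s\<close>.\<close>

definition move :: "bool list \<Rightarrow> bool list \<Rightarrow> bool list \<Rightarrow> nat \<Rightarrow> bool list" where
  "move p x s i =
     take (length p - zeros_before p) p @ replicate (zeros_before p - i) False @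
     x @ replicate i False @ s"

definition dexter_edges :: "nat \<Rightarrow> (bool list \<times> bool list) set" where
  "dexter_edges n = {(w, move p x s i) | w p x s i.
     w \<in> dyck n \<and> movable w p x s \<and> 1 \<le> i \<and> i \<le> zeros_before p}"

definition dexter_le :: "nat \<Rightarrow> bool list \<Rightarrow> bool list \<Rightarrow> bool" where
  "dexter_le n u v \<longleftrightarrow> u \<in> dyck n \<and> v \<in> dyck n \<and> (u, v) \<in> (dexter_edges n)\<^sup>*"

definition dexter_intervals :: "nat \<Rightarrow> (bool list \<times> bool list) set" where
  "dexter_intervals n = {(u, v) \<in> dyck n \<times> dyck n. dexter_le n u v}"

end

theory Submission
  imports Defs "HOL-Computational_Algebra.Formal_Power_Series" "HOL-Computational_Algebra.Polynomial"
begin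

text \<open>
  Read Dyck words as plane forests. If \<open>v = 1 V 0\<close> is prime with \<open>V = G C\<close>, \<open>C\<close> prime, then
  \<open>u = 1 B 0 S\<close> lies below \<open>v\<close> iff \<open>B S\<close> lies below \<open>G C\<close> and \<open>B\<close> without its last prime factor
  is not longer than \<open>G\<close>; and being below is compatible with concatenation. So an interval with
  prime upper end is an interval below \<open>G C\<close>, i.e. \<open>L R\<close> with \<open>L \<le> G\<close>, \<open>R \<le> C\<close>, together with a cut
  of \<open>L R\<close> after at most one prime factor of \<open>R\<close>.
  Counting by size (\<open>t\<close>) and number of prime factors of the lower end (\<open>y\<close>) gives
  \<open>J = 1 / (1 - K)\<close> and \<open>K(y) = t y + t K(y) (y\<^sup>2 J(y) - J(1)) / (y - 1)\<close>.
  With \<open>t = z - 2 z\<^sup>2\<close> and \<open>c = 1 + q y c\<^sup>2\<close>, \<open>q = t / (1 - z)\<^sup>2\<close>, the solution is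
  \<open>J = c (1 - z c) / (1 - z)\<close>, whence \<open>J(1) = (1 - 3 z + z\<^sup>2) / (1 - 2 z)\<^sup>2\<close>, whose coefficients
  satisfy a two-term recurrence.
\<close>

subsection \<open>Plane forests and Dyck words\<close>

datatype plane_tree = Node "plane_tree list"

fun fsize :: "plane_tree list \<Rightarrow> nat" where
  "fsize [] = 0"
| "fsize (Node ts # fs) = Suc (fsize ts + fsize fs)"

fun word :: "plane_tree list \<Rightarrow> bool list" where
  "word [] = []"
| "word (Node ts # fs) = True # word ts @ False # word fs"

lemma fsize_append [simp]: "fsize (fs @ gs) = fsize fs + fsize gs"
  by (induction fs rule: fsize.induct) auto

lemma fsize_eq_0_iff [simp]: "fsize fs = 0 \<longleftrightarrow> fs = []"
  by (cases fs rule: fsize.cases) auto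

lemma word_append [simp]: "word (fs @ gs) = word fs @ word gs"
  by (induction fs rule: word.induct) auto

lemma word_eq_Nil_iff [simp]: "word fs = [] \<longleftrightarrow> fs = []"
  by (cases fs rule: word.cases) auto

lemma hd_word: "fs \<noteq> [] \<Longrightarrow> hd (word fs) = True"
  by (cases fs rule: word.cases) auto

text \<open>The letter 0 behind a forest word is the first place where the height becomes negative,
  so it marks the end of the forest. This is what makes \<open>word\<close> injective.\<close>

lemma word_closed_cancel:
  "word fs @ False # s = word gs @ False # s' \<Longrightarrow> fs = gs \<and> s = s'"
proof (induction fs arbitrary: gs s s' rule: word.induct)
  case 1
  then show ?case by (cases gs rule: word.cases) auto
next
  case (2 ts fs)
  from 2(3) obtain ts' fs' where gs: "gs = Node ts' # fs'"
    by (cases gs rule: word.cases) auto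
  from 2(3) have *: "word ts @ False # (word fs @ False # s) = word ts' @ False # (word fs' @ False # s')"
    unfolding gs by (simp only: word.simps append.simps append_assoc list.inject)
  then have "ts = ts'" "word fs @ False # s = word fs' @ False # s'"
    using 2(1) by blast+
  then show ?case using 2(2) gs by blast
qed

lemma word_inject: "word fs = word gs \<longleftrightarrow> fs = gs"
  using word_closed_cancel[of fs "[]" gs "[]"] by auto

lemma word_singleton_cancel:
  "word [t] @ s = word [t'] @ s' \<Longrightarrow> t = t' \<and> s = s'"
  by (cases t; cases t') (auto dest: word_closed_cancel)

section \<open>Heights, balanced words and first-return decomposition\<close>

lemma height_Nil [simp]: "height [] = 0"
  by (simp add: height_def)

lemma height_Cons [simp]: "height (c # w) = (if c then 1 else - 1) + height w"
  by (simp add: height_def)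

lemma height_append [simp]: "height (u @ v) = height u + height v"
  by (induction u) auto

lemma height_word [simp]: "height (word fs) = 0"
  by (induction fs rule: word.induct) auto

lemma length_word [simp]: "length (word fs) = 2 * fsize fs"
  by (induction fs rule: word.induct) auto

lemma word_prefix_nonneg: "word fs = u @ v \<Longrightarrow> 0 \<le> height u"
proof (induction fs arbitrary: u v rule: word.induct)
  case (2 ts fs)
  show ?case
  proof (cases u)
    case (Cons c u')
    with 2(3) have eq: "word ts @ False # word fs = u' @ v" and c: "c" by auto
    from eq consider us where "word ts = u' @ us" | us where "u' = word ts @ us" "False # word fs = us @ v"
      by (auto simp: append_eq_append_conv2)
    then show ?thesis
    proof cases
      case 1
      then show ?thesis using 2(1) Cons c by fastforce
    next
      case (2 us)
      show ?thesis
      proof (cases us)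
        case (Cons d us')
        with 2 have "word fs = us' @ v" "\<not> d" by auto
        then have "0 \<le> height us'" using "2.IH"(2) by blast
        then show ?thesis using \<open>u = c # u'\<close> 2 Cons c \<open>\<not> d\<close> by simp
      qed (use 2 \<open>u = c # u'\<close> c in simp)
    qed
  qed simp
qed simp

definition balanced :: "bool list \<Rightarrow> bool" where
  "balanced w \<longleftrightarrow> height w = 0 \<and> (\<forall>k. 0 \<le> height (take k w))"

text \<open>Heights add up under concatenation, so the condition in \<open>is_subpath\<close> does
  not depend on the prefix; this is what remains once the starting height is cancelled.\<close>

definition prime_word :: "bool list \<Rightarrow> bool" where
  "prime_word x \<longleftrightarrow> x \<noteq> [] \<and> height x = 0 \<and> (\<forall>k. 0 < k \<and> k < length x \<longrightarrow> 0 < height (take k x))"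

lemma balanced_word: "balanced (word fs)"
  unfolding balanced_def using word_prefix_nonneg[OF append_take_drop_id[symmetric]] by simp

lemma prime_word_singleton: "prime_word (word [t])"
proof (cases t)
  case (Node ts)
  have "0 < height (take k (word [t]))" if "0 < k" "k < length (word [t])" for k
  proof -
    from that have "take k (word [t]) = True # take (k - 1) (word ts)"
      by (cases k) (auto simp: Node)
    then show ?thesis using balanced_word[of ts] by (simp add: balanced_def add_pos_nonneg)
  qed
  then show ?thesis by (simp add: prime_word_def Node)
qed

lemma prime_word_decomp:
  assumes "prime_word x"
  obtains y where "x = True # y @ [False]" "balanced y"
proof -
  have ne: "x \<noteq> []" and h0: "height x = 0"
    and pos: "\<And>k. 0 < k \<Longrightarrow> k < length x \<Longrightarrow> 0 < height (take k x)"
    using assms by (auto simp: prime_word_def)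
  have len: "1 < length x"
    using ne h0 by (cases x; cases "tl x") (auto split: if_splits)
  then obtain c z where x1: "x = c # z" by (cases x) auto
  with len have "z \<noteq> []" by auto
  then obtain y d where z: "z = y @ [d]" by (metis rev_exhaust)
  have "0 < height (take 1 x)" using pos[of 1] len by simp
  then have c: c by (simp add: x1 split: if_splits)
  have "0 < height (take (Suc (length y)) x)" using pos[of "Suc (length y)"] by (simp add: x1 z)
  then have hy: "0 \<le> height y" by (simp add: x1 z c)
  with h0 have d: "\<not> d" and hy0: "height y = 0" by (auto simp: x1 z c split: if_splits)
  have "0 \<le> height (take k y)" for k
  proof (cases "k \<le> length y")
    case True
    then have "0 < height (take (Suc k) x)" using pos[of "Suc k"] by (simp add: x1 z)
    then show ?thesis using True by (simp add: x1 z c)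
  qed (simp add: hy0)
  then have "balanced y" using hy0 by (simp add: balanced_def)
  then show ?thesis using that[of y] by (simp add: x1 z c d)
qed

lemma balanced_split:
  assumes "balanced w" "w \<noteq> []"
  obtains x v where "w = x @ v" "prime_word x" "balanced v"
proof -
  \<comment> \<open>The first return to height 0.\<close>
  define k where "k = (LEAST k. 0 < k \<and> height (take k w) = 0)"
  have ex: "0 < length w \<and> height (take (length w) w) = 0"
    using assms by (simp add: balanced_def)
  have k: "0 < k" "height (take k w) = 0"
    using LeastI[of "\<lambda>k. 0 < k \<and> height (take k w) = 0", OF ex] by (auto simp: k_def)
  have kl: "k \<le> length w"
    unfolding k_def
    by (rule Least_le[where P = "\<lambda>k. 0 < k \<and> height (take k w) = 0"]) (use ex in simp)
  have nz: "height (take j w) \<noteq> 0" if "0 < j" "j < k" for j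
    using that not_less_Least[of j "\<lambda>k. 0 < k \<and> height (take k w) = 0"] by (auto simp: k_def)
  have nn: "0 \<le> height (take j w)" for j using assms by (simp add: balanced_def)
  have "prime_word (take k w)"
    unfolding prime_word_def
  proof (intro conjI allI impI)
    fix j assume j: "0 < j \<and> j < length (take k w)"
    then have "take j (take k w) = take j w" "height (take j w) \<noteq> 0" using nz by auto
    then show "0 < height (take j (take k w))" using nn[of j] by simp
  qed (use k assms(2) in auto)
  moreover have "balanced (drop k w)"
  proof -
    have "height (drop k w) = 0"
      using assms(1) k(2) height_append[of "take k w" "drop k w"] by (simp add: balanced_def)
    moreover have "height (take j (drop k w)) \<ge> 0" for j
    proof -
      have "take (k + j) w = take k w @ take j (drop k w)" by (simp add: take_add)
      then show ?thesis using nn[of "k + j"] k(2) by simp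
    qed
    ultimately show ?thesis by (simp add: balanced_def)
  qed
  ultimately show ?thesis using that[of "take k w" "drop k w"] by simp
qed

lemma balanced_imp_word: "balanced w \<Longrightarrow> \<exists>fs. w = word fs"
proof (induction "length w" arbitrary: w rule: less_induct)
  case less
  show ?case
  proof (cases "w = []")
    case True
    then show ?thesis by (intro exI[of _ "[]"]) simp
  next
    case False
    with less.prems obtain x v where w: "w = x @ v" "prime_word x" "balanced v"
      using balanced_split by blast
    from w(2) obtain y where x: "x = True # y @ [False]" "balanced y"
      using prime_word_decomp by blast
    obtain ts fs where "y = word ts" "v = word fs"
      using less.hyps[of y] less.hyps[of v] w x by auto
    then have "w = word (Node ts # fs)" using w x by simp
    then show ?thesis by blast
  qed
qed

lemma balanced_iff_word: "balanced w \<longleftrightarrow> (\<exists>fs. w = word fs)"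
  using balanced_word balanced_imp_word by blast

lemma prime_word_iff: "prime_word x \<longleftrightarrow> (\<exists>t. x = word [t])"
proof
  assume "prime_word x"
  then obtain y where "x = True # y @ [False]" "balanced y" by (rule prime_word_decomp)
  then obtain ts where "x = word [Node ts]" using balanced_imp_word by auto
  then show "\<exists>t. x = word [t]" by blast
qed (auto simp: prime_word_singleton)

lemma count_list_bool: "count_list w True + count_list w False = length w"
  by (induction w) auto

lemma dyck_iff_balanced: "w \<in> dyck n \<longleftrightarrow> length w = 2 * n \<and> balanced w"
proof -
  have "(\<forall>k\<le>length w. 0 \<le> height (take k w)) \<longleftrightarrow> (\<forall>k. 0 \<le> height (take k w))" if "height w = 0"
    using that by (metis linorder_le_cases order_refl take_all)
  then show ?thesis
    using count_list_bool[of w] by (auto simp: dyck_def balanced_def height_def)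
qed

lemma dyck_eq_word_image: "dyck n = word ` {fs. fsize fs = n}"
  by (auto simp: dyck_iff_balanced balanced_iff_word)

subsection \<open>Moves on forests\<close>

text \<open>The nodes on the rightmost branch of a tree correspond to the final zeros of its word.
  Inserting \<open>x\<close> as new last child of such a node moves it left past as many zeros as
  there are nodes from the root down to that node, both included.\<close>

inductive graft :: "plane_tree \<Rightarrow> plane_tree \<Rightarrow> plane_tree \<Rightarrow> bool" where
  graft_here: "graft (Node ts) x (Node (ts @ [x]))"
| graft_last: "graft c x c' \<Longrightarrow> graft (Node (ts @ [c])) x (Node (ts @ [c']))"

text \<open>
  At ground level every tree but the first is movable. Among the children of a node the last one
  is followed by the letter 0 and cannot move, although its own descendants can.
\<close>

inductive edge :: "plane_tree list \<Rightarrow> plane_tree list \<Rightarrow> bool"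
  and inner_edge :: "plane_tree list \<Rightarrow> plane_tree list \<Rightarrow> bool" where
  edge_graft: "graft t x t' \<Longrightarrow> edge (fs @ [t, x] @ gs) (fs @ [t'] @ gs)"
| edge_Node: "inner_edge ts ts' \<Longrightarrow> edge (fs @ [Node ts] @ gs) (fs @ [Node ts'] @ gs)"
| inner_edge_butlast: "edge fs fs' \<Longrightarrow> inner_edge (fs @ [c]) (fs' @ [c])"
| inner_edge_last: "inner_edge ts ts' \<Longrightarrow> inner_edge (fs @ [Node ts]) (fs @ [Node ts'])"

lemma fsize_graft: "graft t x t' \<Longrightarrow> fsize [t'] = fsize [t] + fsize [x]"
  by (induction rule: graft.induct) auto

lemma fsize_Cons: "fsize (t # fs) = fsize [t] + fsize fs"
  by (cases t) simp

lemma fsize_edge: "edge fs fs' \<Longrightarrow> fsize fs' = fsize fs"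
  and fsize_inner_edge: "inner_edge gs gs' \<Longrightarrow> fsize gs' = fsize gs"
proof (induction rule: edge_inner_edge.inducts)
  case (edge_graft t x t' fs gs)
  then show ?case
    using fsize_graft[of t x t'] fsize_Cons[of t "x # gs"] fsize_Cons[of x gs] fsize_Cons[of t' gs]
    by simp
qed simp_all

lemma edge_context:
  assumes "edge fs fs'"
  shows "edge (p @ fs @ s) (p @ fs' @ s)"
  using assms
proof (cases rule: edge.cases)
  case (edge_graft t x t' gs hs)
  then show ?thesis using edge_inner_edge.edge_graft[of t x t' "p @ gs" "hs @ s"] by simp
next
  case (edge_Node ts ts' gs hs)
  then show ?thesis using edge_inner_edge.edge_Node[of ts ts' "p @ gs" "hs @ s"] by simp
qed

lemma inner_edge_context:
  assumes "inner_edge fs fs'"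
  shows "inner_edge (p @ fs) (p @ fs')"
  using assms
proof (cases rule: inner_edge.cases)
  case (inner_edge_butlast gs gs' c)
  then show ?thesis
    using edge_inner_edge.inner_edge_butlast[OF edge_context[of gs gs' p "[]"]] by simp
next
  case (inner_edge_last ts ts' gs)
  then show ?thesis using edge_inner_edge.inner_edge_last[of ts ts' "p @ gs"] by simp
qed

lemma inner_edge_imp_edge:
  assumes "inner_edge fs fs'"
  shows "edge (fs @ s) (fs' @ s)"
  using assms
proof (cases rule: inner_edge.cases)
  case (inner_edge_butlast gs gs' c)
  then show ?thesis using edge_context[of gs gs' "[]" "c # s"] by simp
next
  case (inner_edge_last ts ts' gs)
  then show ?thesis using edge_Node[of ts ts' gs s] by simp
qed

lemma inner_edge_Node: "inner_edge ts ts' \<Longrightarrow> inner_edge (Node ts # fs) (Node ts' # fs)"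
proof (cases fs rule: rev_cases)
  case (snoc gs c)
  assume "inner_edge ts ts'"
  then show ?thesis
    using inner_edge_butlast[OF edge_Node[of ts ts' "[]" gs]] snoc by simp
qed (use inner_edge_last[of ts ts' "[]"] in simp)

text \<open>The suffix \<open>s\<close> behind the moved subpath is a parameter because it decides
  movability: at ground level it may be empty, but inside a node an empty \<open>s\<close> would put
  the closing 0 right behind the subpath.\<close>

definition slide :: "bool list \<Rightarrow> bool list \<Rightarrow> bool list \<Rightarrow> bool" where
  "slide s w w' \<longleftrightarrow> (\<exists>a i x. 1 \<le> i \<and> w = a @ replicate i False @ word [x] @ s \<and>
     w' = a @ word [x] @ replicate i False @ s)"

lemma slide_context: "slide s w w' \<Longrightarrow> slide (s @ q) (p @ w @ q) (p @ w' @ q)"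
  unfolding slide_def
proof (elim exE conjE)
  fix a i x
  assume "1 \<le> i" "w = a @ replicate i False @ word [x] @ s" "w' = a @ word [x] @ replicate i False @ s"
  then show "\<exists>a i x. 1 \<le> i \<and> p @ w @ q = a @ replicate i False @ word [x] @ s @ q \<and>
     p @ w' @ q = a @ word [x] @ replicate i False @ s @ q"
    by (intro exI[of _ "p @ a"] exI[of _ i] exI[of _ x]) simp
qed

lemma word_graft:
  "graft t x t' \<Longrightarrow> \<exists>b i. 1 \<le> i \<and> word [t] = b @ replicate i False \<and>
     word [t'] = b @ word [x] @ replicate i False"
proof (induction rule: graft.induct)
  case (graft_here ts x)
  show ?case by (intro exI[of _ "True # word ts"] exI[of _ 1]) simp
next
  case (graft_last c x c' ts)
  then obtain b i where "1 \<le> i" "word [c] = b @ replicate i False"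
    "word [c'] = b @ word [x] @ replicate i False" by blast
  then show ?case
    by (intro exI[of _ "True # word ts @ b"] exI[of _ "Suc i"])
      (simp add: replicate_append_same)
qed

lemma edge_imp_slide:
    "edge fs fs' \<Longrightarrow> \<exists>s. (s = [] \<or> hd s) \<and> slide s (word fs) (word fs')"
  and inner_edge_imp_slide:
    "inner_edge gs gs' \<Longrightarrow> \<exists>s. s \<noteq> [] \<and> hd s \<and> slide s (word gs) (word gs')"
proof (induction rule: edge_inner_edge.inducts)
  case (edge_graft t x t' fs gs)
  then obtain b i where "1 \<le> i" "word [t] = b @ replicate i False"
    "word [t'] = b @ word [x] @ replicate i False" using word_graft by blast
  moreover have "word (fs @ [t, x] @ gs) = word fs @ word [t] @ word [x] @ word gs"
    "word (fs @ [t'] @ gs) = word fs @ word [t'] @ word gs"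
    by (metis append_Cons append_Nil append_assoc word_append)+
  ultimately have "slide (word gs) (word (fs @ [t, x] @ gs)) (word (fs @ [t'] @ gs))"
    unfolding slide_def
    by (intro exI[of _ "word fs @ b"] exI[of _ i] exI[of _ x]) simp
  then show ?case using hd_word by (metis (full_types) word_eq_Nil_iff)
next
  case (edge_Node ts ts' fs gs)
  then obtain s where "s \<noteq> []" "hd s" "slide s (word ts) (word ts')" by blast
  then show ?case
    using slide_context[of s "word ts" "word ts'" "False # word gs" "word fs @ [True]"]
    by (intro exI[of _ "s @ False # word gs"]) simp
next
  case (inner_edge_butlast fs fs' c)
  then obtain s where "s = [] \<or> hd s" "slide s (word fs) (word fs')" by blast
  then show ?case
    using slide_context[of s "word fs" "word fs'" "word [c]" "[]"] hd_word[of "[c]"]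
    by (intro exI[of _ "s @ word [c]"]) (auto simp: hd_append)
next
  case (inner_edge_last ts ts' fs)
  then obtain s where "s \<noteq> []" "hd s" "slide s (word ts) (word ts')" by blast
  then show ?case
    using slide_context[of s "word ts" "word ts'" "[False]" "word fs @ [True]"]
    by (intro exI[of _ "s @ [False]"]) simp
qed

text \<open>Induction on the number of crossed zeros walks down the rightmost branch: the last 0
  closes the root, and the remaining ones end the word of the last child.\<close>

lemma graft_of_word:
  "word [t] = b @ replicate i False \<Longrightarrow> 1 \<le> i \<Longrightarrow>
    \<exists>t'. graft t x t' \<and> word [t'] = b @ word [x] @ replicate i False"
proof (induction i arbitrary: t b)
  case (Suc i)
  obtain ts where t: "t = Node ts" by (cases t)
  have *: "True # word ts @ [False] = (b @ replicate i False) @ [False]"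
    using Suc.prems(1) by (simp add: t replicate_append_same)
  show ?case
  proof (cases "i = 0")
    case True
    with * have "b = True # word ts" by simp
    then show ?thesis using graft_here[of ts x] True t by (intro exI[of _ "Node (ts @ [x])"]) simp
  next
    case False
    from * have **: "True # word ts = b @ replicate i False" by (metis append_Cons butlast_snoc)
    with False obtain b' where b: "b = True # b'" by (cases b; cases i) auto
    with ** have w: "word ts = b' @ replicate i False" by simp
    then have "ts \<noteq> []" using False by auto
    then obtain gs c where ts: "ts = gs @ [c]" by (metis rev_exhaust)
    have "\<exists>us. word [c] = us @ replicate i False \<and> b' = word gs @ us"
    proof -
      have "word gs @ word [c] = b' @ replicate i False" using w ts by simp
      then consider us where "word gs @ us = b'" "word [c] = us @ replicate i False"
        | us where "word gs = b' @ us" "us @ word [c] = replicate i False"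
        by (auto simp: append_eq_append_conv2)
      then show ?thesis
      proof cases
        case 2
        have "True \<in> set (word [c])" by (cases c) simp
        then have "True \<in> set (replicate i False)" using 2(2) by (metis UnI2 set_append)
        then show ?thesis by (simp split: if_splits)
      qed blast
    qed
    then obtain us where us: "word [c] = us @ replicate i False" "b' = word gs @ us" by blast
    then obtain c' where "graft c x c'" "word [c'] = us @ word [x] @ replicate i False"
      using Suc.IH[of c us] False by auto
    then show ?thesis using graft_last[of c x c' gs] us b ts t
      by (intro exI[of _ "Node (gs @ [c'])"]) (simp add: replicate_append_same)
  qed
qed simp

lemma replicate_suffix:
  "u @ replicate i False = v @ True # z \<Longrightarrow> \<exists>z'. z = z' @ replicate i False"
proof (induction i arbitrary: z)
  case (Suc i)
  then have eq: "(u @ replicate i False) @ [False] = v @ True # z"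
    by (simp add: replicate_append_same)
  show ?case
  proof (cases z rule: rev_cases)
    case (snoc z1 d)
    with eq have "u @ replicate i False = v @ True # z1" "\<not> d" by auto
    then show ?thesis using Suc.IH[of z1] snoc by (auto simp: replicate_append_same)
  qed (use eq in auto)
qed auto

text \<open>The first tree is peeled off. The slid tree lies inside it, or comes right behind it,
  which is a graft, or lies farther right together with all crossed zeros. Both kinds of edges are
  proved at once because the inside case needs an inner edge.\<close>

lemma edge_of_slide_word:
  "word fs = a @ replicate i False @ word [x] @ s \<Longrightarrow> 1 \<le> i \<Longrightarrow> s = [] \<or> hd s \<Longrightarrow>
    \<exists>fs'. word fs' = a @ word [x] @ replicate i False @ s \<and> edge fs fs' \<and> (s \<noteq> [] \<longrightarrow> inner_edge fs fs')"
proof (induction fs arbitrary: a s rule: word.induct)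
  case 1
  then show ?case by (cases x) auto
next
  case (2 ts fs)
  note eq = \<open>word (Node ts # fs) = a @ replicate i False @ word [x] @ s\<close>
  have "a \<noteq> []" using eq \<open>1 \<le> i\<close> by (cases i) auto
  with eq obtain a' where a: "a = True # a'" by (cases a) auto
  define p where "p = a' @ replicate i False"
  have eq': "word ts @ False # word fs = p @ word [x] @ s" using eq by (simp add: a p_def)
  from eq' consider (inside) r where "word ts = p @ r" "r @ False # word fs = word [x] @ s"
    | (after) r where "p = word ts @ r" "r \<noteq> []" "False # word fs = r @ word [x] @ s"
    by (auto simp: append_eq_append_conv2) (metis append_Nil2)
  then show ?case
  proof cases
    case (inside r)
    have hr: "height r \<le> 0"
      using word_prefix_nonneg[OF inside(1)] height_word[of ts] inside(1) by simp
    \<comment> \<open>\<open>word ts\<close> has height 0 and its prefix \<open>p\<close> has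
      nonnegative height, so \<open>r\<close> has height at most 0. A slid tree reaching past the
      closing 0 would have a prefix of negative height.\<close>
    obtain s' where s': "r = word [x] @ s'" "s = s' @ False # word fs"
    proof -
      from inside(2) consider us where "r = word [x] @ us" "us @ False # word fs = s"
        | us where "word [x] = r @ us" "us \<noteq> []" "False # word fs = us @ s"
        by (auto simp: append_eq_append_conv2) (metis append_Nil2)
      then show ?thesis
      proof cases
        case 2
        then obtain us' where us: "us = False # us'" by (cases us) auto
        then have "0 \<le> height (r @ [False])"
          using word_prefix_nonneg[of "[x]" "r @ [False]" us'] 2(1) by simp
        then show ?thesis using hr by simp
      qed (use that in blast)
    qed
    have "s' \<noteq> []" "hd s'" using s'(2) \<open>s = [] \<or> hd s\<close> by (cases s'; auto)+
    then obtain ts' where ts': "word ts' = a' @ word [x] @ replicate i False @ s'" "inner_edge ts ts'"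
      using 2(1)[of a' s'] inside(1) s'(1) \<open>1 \<le> i\<close> by (auto simp: p_def)
    have "edge (Node ts # fs) (Node ts' # fs)" using edge_Node[OF ts'(2), of "[]" fs] by simp
    then show ?thesis using inner_edge_Node[OF ts'(2)] ts'(1) s'(2) a
      by (intro exI[of _ "Node ts' # fs"]) simp
  next
    case (after r)
    then obtain r' where r: "r = False # r'" by (cases r) auto
    with after have f: "word fs = r' @ word [x] @ s" by simp
    have p: "p = word ts @ False # r'" using after r by simp
    show ?thesis
    proof (cases "r' = []")
      case True
      obtain y fs1 where fs: "fs = y # fs1" using f by (cases fs; cases x) auto
      have "word [y] @ word fs1 = word [x] @ s" using f True fs word_append[of "[y]" fs1] by simp
      then have y: "y = x" "s = word fs1" using word_singleton_cancel by blast+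
      have "word [Node ts] = a @ replicate i False" using p True by (simp add: a p_def)
      then obtain t' where t': "graft (Node ts) x t'" "word [t'] = a @ word [x] @ replicate i False"
        using graft_of_word \<open>1 \<le> i\<close> by blast
      have e: "edge (Node ts # x # gs) (t' # gs)" for gs
        using edge_graft[OF t'(1), of "[]" gs] by simp
      have "inner_edge (Node ts # fs) (t' # fs1)" if "s \<noteq> []"
      proof -
        from that obtain gs c where "fs1 = gs @ [c]" using y by (metis rev_exhaust word_eq_Nil_iff)
        then show ?thesis using inner_edge_butlast[OF e[of gs]] fs y by simp
      qed
      moreover have "word (t' # fs1) = word [t'] @ word fs1" using word_append[of "[t']" fs1] by simp
      ultimately show ?thesis using e[of fs1] fs y t'(2) by (intro exI[of _ "t' # fs1"]) simp
    next
      case False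
      \<comment> \<open>\<open>r'\<close> begins with 1, so the zeros ending \<open>p\<close> all
        lie within \<open>r'\<close>.\<close>
      have "\<exists>r''. r' = r'' @ replicate i False"
      proof -
        have "hd r'" using f False hd_word[of fs] by (metis append_is_Nil_conv hd_append2 word_eq_Nil_iff)
        then obtain z where z: "r' = True # z" using False by (cases r') auto
        then have "a' @ replicate i False = (word ts @ [False]) @ True # z" using p p_def by simp
        then obtain z' where "z = z' @ replicate i False" using replicate_suffix by blast
        then show ?thesis using z by (intro exI[of _ "True # z'"]) simp
      qed
      then obtain r'' where r'': "r' = r'' @ replicate i False" by blast
      with f have "word fs = r'' @ replicate i False @ word [x] @ s" by simp
      then obtain fs' where fs': "word fs' = r'' @ word [x] @ replicate i False @ s"
        "edge fs fs'" "s \<noteq> [] \<longrightarrow> inner_edge fs fs'"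
        using 2(2)[of r'' s] 2 by blast
      have a'': "a' = word ts @ False # r''" using p r'' by (simp add: p_def)
      show ?thesis
        using fs' edge_context[OF fs'(2), of "[Node ts]" "[]"] inner_edge_context[of fs fs' "[Node ts]"]
        by (intro exI[of _ "Node ts # fs'"]) (simp add: a a'')
    qed
  qed
qed

section \<open>Dexter edges as edges of forests\<close>

lemma zeros_before_replicate: "i \<le> zeros_before (a @ replicate i False)"
proof -
  have "takeWhile (\<lambda>c. c = False) (replicate i False @ rev a) =
    replicate i False @ takeWhile (\<lambda>c. c = False) (rev a)"
    by (subst takeWhile_append2) auto
  then show ?thesis by (simp add: zeros_before_def)
qed

lemma zeros_before_split: "p = take (length p - zeros_before p) p @ replicate (zeros_before p) False"
proof -
  let ?P = "\<lambda>c. c = False"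
  have rep: "takeWhile ?P (rev p) = replicate (zeros_before p) False"
    unfolding zeros_before_def by (rule replicate_eqI) (auto dest: set_takeWhileD)
  have "rev p = replicate (zeros_before p) False @ dropWhile ?P (rev p)"
    using takeWhile_dropWhile_id[of ?P "rev p"] unfolding rep by (rule sym)
  then have "p = rev (dropWhile ?P (rev p)) @ replicate (zeros_before p) False"
    by (metis rev_append rev_replicate rev_rev_ident)
  then show ?thesis
    by (metis append_eq_conv_conj append_take_drop_id diff_add_inverse2 length_append length_replicate)
qed

lemma movable_iff:
  "movable w p x s \<longleftrightarrow> w = p @ x @ s \<and> (\<exists>t. x = word [t]) \<and> p \<noteq> [] \<and> \<not> last p \<and> (s = [] \<or> hd s)"
proof -
  have "is_subpath w p x s \<longleftrightarrow> w = p @ x @ s \<and> prime_word x"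
    by (auto simp: is_subpath_def prime_word_def)
  then show ?thesis by (auto simp: movable_def prime_word_iff)
qed

lemma dexter_edges_eq: "dexter_edges n = {(word fs, word fs') | fs fs'. edge fs fs' \<and> fsize fs = n}"
proof (intro equalityI subsetI)
  fix e assume "e \<in> dexter_edges n"
  then obtain w p x s i where e: "e = (w, move p x s i)" "w \<in> dyck n" "movable w p x s"
    "1 \<le> i" "i \<le> zeros_before p"
    by (auto simp: dexter_edges_def)
  obtain fs where fs: "w = word fs" "fsize fs = n" using e(2) by (auto simp: dyck_eq_word_image)
  \<comment> \<open>\<open>a\<close> also takes up the zeros that are not crossed, so the maximal
    block of length N disappears from the description.\<close>
  define a where "a = take (length p - zeros_before p) p @ replicate (zeros_before p - i) False"
  have p: "p = a @ replicate i False"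
    using zeros_before_split[of p] e(5) by (simp add: a_def flip: replicate_add)
  obtain t where t: "x = word [t]" "s = [] \<or> hd s" "w = p @ x @ s"
    using e(3) by (auto simp: movable_iff)
  have "word fs = a @ replicate i False @ word [t] @ s" using t p fs by simp
  then obtain fs' where "word fs' = a @ word [t] @ replicate i False @ s" "edge fs fs'"
    using edge_of_slide_word e(4) t(2) by blast
  moreover have "move p x s i = a @ word [t] @ replicate i False @ s"
    by (simp add: move_def a_def t(1))
  ultimately show "e \<in> {(word fs, word fs') | fs fs'. edge fs fs' \<and> fsize fs = n}"
    using e(1) fs by auto metis
next
  fix e assume "e \<in> {(word fs, word fs') | fs fs'. edge fs fs' \<and> fsize fs = n}"
  then obtain fs fs' where e: "e = (word fs, word fs')" "edge fs fs'" "fsize fs = n" by auto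
  then obtain s a i x where s: "s = [] \<or> hd s" "1 \<le> i" "word fs = a @ replicate i False @ word [x] @ s"
     "word fs' = a @ word [x] @ replicate i False @ s"
    using edge_imp_slide[OF e(2)] by (auto simp: slide_def)
  define p where "p = a @ replicate i False"
  have "p \<noteq> []" "\<not> last p" using s(2) by (auto simp: p_def)
  then have "movable (word fs) p (word [x]) s" using s by (auto simp: movable_iff p_def)
  moreover have "move p (word [x]) s i = word fs'"
  proof -
    have "take (length p - zeros_before p) p @ replicate (zeros_before p - i) False = a"
    proof -
      have "p = take (length p - zeros_before p) p @ replicate (zeros_before p - i) False @ replicate i False"
        using zeros_before_split[of p] zeros_before_replicate[of i a]
        by (simp add: p_def flip: replicate_add)
      then show ?thesis by (metis append_assoc append_same_eq p_def)
    qed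
    then show ?thesis unfolding move_def s(4) by (metis append_assoc)
  qed
  moreover have "word fs \<in> dyck n" using e(3) by (auto simp: dyck_eq_word_image)
  moreover have "i \<le> zeros_before p" by (simp add: p_def zeros_before_replicate)
  ultimately show "e \<in> dexter_edges n"
    unfolding dexter_edges_def mem_Collect_eq using e(1) s(2)
    by (intro exI[of _ "word fs"] exI[of _ p] exI[of _ "word [x]"] exI[of _ s] exI[of _ i]) simp
qed

lemma fsize_edge_rtranclp: "edge\<^sup>*\<^sup>* fs gs \<Longrightarrow> fsize gs = fsize fs"
  by (induction rule: rtranclp_induct) (auto dest: fsize_edge)

lemma dexter_edges_rtrancl_word:
  assumes "fsize fs = n"
  shows "(word fs, w) \<in> (dexter_edges n)\<^sup>* \<longleftrightarrow> (\<exists>gs. w = word gs \<and> edge\<^sup>*\<^sup>* fs gs)"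
proof
  assume "(word fs, w) \<in> (dexter_edges n)\<^sup>*"
  then show "\<exists>gs. w = word gs \<and> edge\<^sup>*\<^sup>* fs gs"
  proof (induction rule: rtrancl_induct)
    case (step w w')
    then show ?case by (auto simp: dexter_edges_eq word_inject intro: rtranclp.rtrancl_into_rtrancl)
  qed auto
next
  assume "\<exists>gs. w = word gs \<and> edge\<^sup>*\<^sup>* fs gs"
  then obtain gs where w: "w = word gs" and "edge\<^sup>*\<^sup>* fs gs" by blast
  from this(2) have "(word fs, word gs) \<in> (dexter_edges n)\<^sup>*"
  proof (induction rule: rtranclp_induct)
    case (step gs hs)
    then have "(word gs, word hs) \<in> dexter_edges n"
      using fsize_edge_rtranclp[of fs gs] assms by (auto simp: dexter_edges_eq)
    with step.IH show ?case by (rule rtrancl_into_rtrancl)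
  qed simp
  then show "(word fs, w) \<in> (dexter_edges n)\<^sup>*" using w by simp
qed

subsection \<open>Recursive description of the order\<close>

text \<open>\<open>below_tree\<close> has a forest on the left since a word below a prime word need
  not be prime. In its last rule \<open>b\<close> counts the trees placed under the first root; the
  bound lets at most the first tree of \<open>rs\<close> join those of \<open>ls\<close>.\<close>

inductive below :: "plane_tree list \<Rightarrow> plane_tree list \<Rightarrow> bool"
  and below_tree :: "plane_tree list \<Rightarrow> plane_tree \<Rightarrow> bool" where
  below_Nil: "below [] []"
| below_Cons: "below_tree us t \<Longrightarrow> below vs ts \<Longrightarrow> below (us @ vs) (t # ts)"
| below_tree_leaf: "below_tree [Node []] (Node [])"
| below_tree_Node: "below ls gs \<Longrightarrow> below_tree rs c \<Longrightarrow> b \<le> Suc (length ls) \<Longrightarrow>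
    below_tree (Node (take b (ls @ rs)) # drop b (ls @ rs)) (Node (gs @ [c]))"

lemma fsize_below: "below us ts \<Longrightarrow> fsize us = fsize ts"
  and fsize_below_tree: "below_tree us t \<Longrightarrow> fsize us = fsize [t]"
proof (induction rule: below_below_tree.inducts)
  case (below_Cons us t vs ts)
  then show ?case using fsize_Cons[of t ts] by simp
next
  case (below_tree_Node ls gs rs c b)
  have "fsize (take b (ls @ rs)) + fsize (drop b (ls @ rs)) = fsize (ls @ rs)"
    by (metis append_take_drop_id fsize_append)
  then show ?case using below_tree_Node by simp
qed simp_all

lemma fsize_pos_iff [simp]: "0 < fsize ts \<longleftrightarrow> ts \<noteq> []"
  using fsize_eq_0_iff[of ts] by linarith

lemma below_tree_not_Nil: "below_tree us t \<Longrightarrow> us \<noteq> []"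
  by (auto elim: below_tree.cases)

lemma below_singleton_iff: "below us [t] \<longleftrightarrow> below_tree us t"
proof
  assume "below us [t]"
  then show "below_tree us t"
  proof (cases rule: below.cases)
    case (below_Cons us' vs)
    from \<open>below vs []\<close> have "vs = []" by (cases rule: below.cases) auto
    with below_Cons show ?thesis by simp
  qed
qed (use below_Cons[OF _ below_Nil] in fastforce)

lemma below_append: "below us ts \<Longrightarrow> below us' ts' \<Longrightarrow> below (us @ us') (ts @ ts')"
proof (induction ts arbitrary: us)
  case (Cons t ts)
  from Cons.prems(1) obtain vs ws where "us = vs @ ws" "below_tree vs t" "below ws ts"
    by (cases rule: below.cases) auto
  then show ?case using below_Cons[of vs t "ws @ us'" "ts @ ts'"] Cons by simp
qed (auto elim: below.cases)

lemma below_appendE: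
  assumes "below ws (ts @ ts')"
  obtains us us' where "ws = us @ us'" "below us ts" "below us' ts'"
proof -
  have "\<exists>us us'. ws = us @ us' \<and> below us ts \<and> below us' ts'"
    using assms
  proof (induction ts arbitrary: ws)
    case Nil
    then show ?case using below_Nil by (intro exI[of _ "[]"] exI[of _ ws]) simp
  next
    case (Cons t ts)
    from Cons.prems obtain vs xs where v: "ws = vs @ xs" "below_tree vs t" "below xs (ts @ ts')"
      by (cases rule: below.cases) auto
    then obtain us us' where "xs = us @ us'" "below us ts" "below us' ts'" using Cons.IH by blast
    then show ?case using v below_Cons[of vs t us ts] by (intro exI[of _ "vs @ us"] exI[of _ us']) simp
  qed
  then show ?thesis using that by blast
qed

lemma fsize_take_le: "fsize (take k fs) \<le> fsize fs"
  by (metis append_take_drop_id fsize_append le_add1)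

text \<open>Counting needs a bound on the number of trees, while edges respect a bound on sizes;
  this lemma and the next exchange the two. If \<open>bs\<close> had too many trees,
  \<open>butlast bs\<close> would contain \<open>ls\<close> and a further tree, exceeding the common
  size of \<open>ls\<close> and \<open>gs\<close>.\<close>

lemma below_tree_NodeI:
  assumes "below (bs @ ss) (gs @ [c])" "fsize (butlast bs) \<le> fsize gs"
  shows "below_tree (Node bs # ss) (Node (gs @ [c]))"
proof -
  obtain ls rs where w: "bs @ ss = ls @ rs" "below ls gs" "below_tree rs c"
    using assms(1) by (auto elim: below_appendE simp: below_singleton_iff)
  have "length bs \<le> Suc (length ls)"
  proof (rule ccontr)
    assume "\<not> length bs \<le> Suc (length ls)"
    then have l: "length ls < length (butlast bs)" by simp
    have "butlast bs @ last bs # ss = ls @ rs" using l w(1)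
      by (metis append.assoc append_Cons append_Nil append_butlast_last_id butlast.simps(1) list.size(3) not_less_zero)
    with l obtain us where us: "butlast bs = ls @ us"
      by (auto simp: append_eq_append_conv2)
    moreover have "us \<noteq> []" using l us by (metis append_Nil2 less_irrefl)
    ultimately show False using assms(2) fsize_below[OF w(2)] by simp
  qed
  then show ?thesis using below_tree_Node[OF w(2,3), of "length bs"] by (simp flip: w(1))
qed

lemma below_tree_NodeE:
  assumes "below_tree us (Node (gs @ [c]))"
  obtains bs ss where "us = Node bs # ss" "below (bs @ ss) (gs @ [c])" "fsize (butlast bs) \<le> fsize gs"
  using assms
proof (cases rule: below_tree.cases)
  case (below_tree_Node ls gs' rs c' b)
  then have *: "gs' = gs" "c' = c" by auto
  have "butlast (take b (ls @ rs)) = take (b - 1) ls" if "b \<le> length (ls @ rs)"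
    unfolding butlast_take[OF that] using below_tree_Node(5) by simp
  \<comment> \<open>A cut beyond the end would force \<open>rs = []\<close>, which
    \<open>below_tree\<close> excludes.\<close>
  moreover have "butlast (take b (ls @ rs)) = ls" if "\<not> b \<le> length (ls @ rs)"
  proof -
    have "rs = []" using that below_tree_Node(5) by (cases rs) auto
    then show ?thesis using below_tree_Node(4) below_tree_not_Nil by blast
  qed
  ultimately have "fsize (butlast (take b (ls @ rs))) \<le> fsize gs"
    using fsize_take_le[of "b - 1" ls] fsize_below[OF below_tree_Node(3)] * by (metis order_refl)
  moreover have "below (ls @ rs) (gs @ [c])"
    using below_append below_tree_Node(3,4) * below_singleton_iff by blast
  ultimately show ?thesis
    using that[of "take b (ls @ rs)" "drop b (ls @ rs)"] below_tree_Node by (simp del: take_append drop_append)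
qed simp

section \<open>Reflexivity and closure under edges\<close>

lemma below_refl: "below ts ts"
proof (induction "fsize ts" arbitrary: ts rule: less_induct)
  case less
  show ?case
  proof (cases ts rule: fsize.cases)
    case (2 vs ws)
    have "below_tree [Node vs] (Node vs)"
    proof (cases vs rule: rev_cases)
      case (snoc gs c)
      have "below vs vs" using less[of vs] 2 by simp
      then show ?thesis using below_tree_NodeI[of vs "[]" gs c] snoc by simp
    qed (use below_tree_leaf in simp)
    moreover have "below ws ws" using less[of ws] 2 by simp
    ultimately show ?thesis using below_Cons[of "[Node vs]" "Node vs" ws ws] 2 by simp
  qed (use below_Nil in simp)
qed

text \<open>An edge produces a single changed tree, which lies on one side of any cut of the target.
  A cut of the source could separate the two trees of a graft.\<close>

lemma edge_appendE:
  assumes "edge us (ws @ ws')"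
  obtains vs where "us = vs @ ws'" "edge vs ws" | vs' where "us = ws @ vs'" "edge vs' ws'"
  using assms
proof (cases rule: edge.cases)
  case (edge_graft t x t' fs gs)
  from \<open>ws @ ws' = fs @ [t'] @ gs\<close>
  consider zs where "ws = fs @ t' # zs" "gs = zs @ ws'" | zs where "fs = ws @ zs" "ws' = zs @ t' # gs"
    by (auto simp: append_eq_append_conv2 append_eq_Cons_conv)
  then show ?thesis
  proof cases
    case 1
    then show ?thesis
      using that(1)[of "fs @ [t, x] @ zs"] edge_inner_edge.edge_graft[of t x t' fs zs] edge_graft by simp
  next
    case 2
    then show ?thesis
      using that(2)[of "zs @ [t, x] @ gs"] edge_inner_edge.edge_graft[of t x t' zs gs] edge_graft by simp
  qed
next
  case (edge_Node ts ts' fs gs)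
  from \<open>ws @ ws' = fs @ [Node ts'] @ gs\<close>
  consider zs where "ws = fs @ Node ts' # zs" "gs = zs @ ws'"
    | zs where "fs = ws @ zs" "ws' = zs @ Node ts' # gs"
    by (auto simp: append_eq_append_conv2 append_eq_Cons_conv)
  then show ?thesis
  proof cases
    case 1
    then show ?thesis
      using that(1)[of "fs @ [Node ts] @ zs"] edge_inner_edge.edge_Node[of ts ts' fs zs] edge_Node by simp
  next
    case 2
    then show ?thesis
      using that(2)[of "zs @ [Node ts] @ gs"] edge_inner_edge.edge_Node[of ts ts' zs gs] edge_Node by simp
  qed
qed

text \<open>Read backwards, a graft at the first root only shifts the cut between B and S; every
  other edge is an edge of B S. Deeper grafts change only the last tree of B, and inner edges keep
  the size of the others, so the size bound survives.\<close>

lemma edge_Node_Cons: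
  assumes "edge us (Node bs' # ss')"
  obtains bs ss where "us = Node bs # ss" "bs @ ss = bs' @ ss' \<or> edge (bs @ ss) (bs' @ ss')"
    "fsize (butlast bs) \<le> fsize (butlast bs')"
proof -
  have "(\<exists>vs. us = vs @ ss' \<and> edge vs [Node bs']) \<or> (\<exists>vs. us = [Node bs'] @ vs \<and> edge vs ss')"
    using assms edge_appendE[of us "[Node bs']" ss'] by auto
  then consider vs where "us = vs @ ss'" "edge vs [Node bs']" | vs where "us = Node bs' # vs" "edge vs ss'"
    by auto
  then show ?thesis
  proof cases
    case 1
    from 1(2) show ?thesis
    proof (cases rule: edge.cases)
      case (edge_graft t x t' fs gs)
      then have *: "vs = [t, x]" "t' = Node bs'" by (auto simp: Cons_eq_append_conv)
      from \<open>graft t x t'\<close> show ?thesis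
      proof (cases rule: graft.cases)
        case (graft_here ts)
        have "fsize (butlast ts) \<le> fsize ts" by (simp add: butlast_conv_take fsize_take_le)
        then show ?thesis using that[of ts "x # ss'"] graft_here * 1 by simp
      next
        case (graft_last c c' ts)
        have "edge (ts @ [c, x] @ ss') (ts @ [c'] @ ss')"
          using edge_inner_edge.edge_graft graft_last by blast
        then show ?thesis using that[of "ts @ [c]" "x # ss'"] graft_last * 1 by simp
      qed
    next
      case (edge_Node ts ts' fs gs)
      then have *: "vs = [Node ts]" "ts' = bs'" by (auto simp: Cons_eq_append_conv)
      then have i: "inner_edge ts bs'" using edge_Node by simp
      then have "fsize (butlast ts) = fsize (butlast bs')"
        by (cases rule: inner_edge.cases) (auto dest: fsize_edge)
      then show ?thesis using that[of ts ss'] * 1 inner_edge_imp_edge[OF i] by simp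
    qed
  next
    case 2
    then show ?thesis using that[of bs' vs] edge_context[of vs ss' bs' "[]"] by simp
  qed
qed

text \<open>Induction on the size of the upper forest: several trees are separated by
  \<open>edge_appendE\<close>, and for a single tree \<open>edge_Node_Cons\<close> leads to its
  smaller forest of children.\<close>

lemma edge_below: "edge us ws \<Longrightarrow> below ws ts \<Longrightarrow> below us ts"
proof (induction "fsize ts" arbitrary: us ws ts rule: less_induct)
  case less
  show ?case
  proof (cases ts rule: fsize.cases)
    case 1
    then have "fsize us = 0" using less.prems fsize_edge fsize_below by fastforce
    then show ?thesis using 1 below_Nil by simp
  next
    case (2 vs ts')
    show ?thesis
    proof (cases "ts' = []")
      case True
      then have t: "ts = [Node vs]" using 2 by simp
      then have w: "below_tree ws (Node vs)" using less.prems below_singleton_iff by simp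
      show ?thesis
      proof (cases vs rule: rev_cases)
        case Nil
        then have "fsize us = 1" "fsize ws = 1" 
          using fsize_edge[OF less.prems(1)] fsize_below[OF less.prems(2)] t by auto
        moreover have "xs = [Node []]" if "fsize xs = 1" for xs
          using that by (cases xs rule: fsize.cases) auto
        ultimately show ?thesis using less.prems(2) by metis
      next
        case (snoc gs c)
        with w obtain bs' ss' where b': "ws = Node bs' # ss'" "below (bs' @ ss') (gs @ [c])"
          "fsize (butlast bs') \<le> fsize gs"
          by (auto elim: below_tree_NodeE)
        from less.prems(1) obtain bs ss where b: "us = Node bs # ss"
          "bs @ ss = bs' @ ss' \<or> edge (bs @ ss) (bs' @ ss')"
          "fsize (butlast bs) \<le> fsize (butlast bs')"
          unfolding b'(1) by (rule edge_Node_Cons)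
        have "below (bs @ ss) (gs @ [c])"
          using b(2) b'(2) less.hyps[of "gs @ [c]" "bs @ ss" "bs' @ ss'"] t snoc by auto
        then show ?thesis
          using below_tree_NodeI b b' t snoc below_singleton_iff by (metis le_trans)
      qed
    next
      case False
      have ts: "ts = [Node vs] @ ts'" using 2 by simp
      then obtain xs xs' where x: "ws = xs @ xs'" "below xs [Node vs]" "below xs' ts'"
        using less.prems(2) below_appendE by metis
      have s: "fsize [Node vs] < fsize ts" "fsize ts' < fsize ts" using 2 False by auto
      from less.prems(1) have "edge us (xs @ xs')" by (simp add: x(1))
      then show ?thesis
      proof (cases rule: edge_appendE)
        case (1 ys)
        then have "below ys [Node vs]" using less.hyps[OF s(1)] x by blast
        then show ?thesis using below_append x ts 1 by blast
      next
        case (2 ys)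
        then have "below ys ts'" using less.hyps[OF s(2)] x by blast
        then show ?thesis using below_append x ts 2 by blast
      qed
    qed
  qed
qed

lemma edge_rtranclp_imp_below: "edge\<^sup>*\<^sup>* us ts \<Longrightarrow> below us ts"
  by (induction rule: converse_rtranclp_induct) (auto intro: below_refl edge_below)

section \<open>Paths realising \<open>below\<close>\<close>

lemma edge_rtranclp_context: "edge\<^sup>*\<^sup>* us vs \<Longrightarrow> edge\<^sup>*\<^sup>* (p @ us @ s) (p @ vs @ s)"
  by (induction rule: rtranclp_induct) (auto intro: rtranclp.rtrancl_into_rtrancl edge_context)

lemma edge_rtranclp_absorb: "edge\<^sup>*\<^sup>* (Node bs # ss) [Node (bs @ ss)]"
proof (induction ss arbitrary: bs)
  case (Cons x ss)
  have "edge (Node bs # x # ss) (Node (bs @ [x]) # ss)"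
    using edge_graft[OF graft_here, of "[]" bs x ss] by simp
  then show ?case using Cons[of "bs @ [x]"] by (simp add: converse_rtranclp_into_rtranclp)
qed simp

lemma edge_rtranclp_butlast: "edge\<^sup>*\<^sup>* us vs \<Longrightarrow> edge\<^sup>*\<^sup>* [Node (us @ [c])] [Node (vs @ [c])]"
proof (induction rule: rtranclp_induct)
  case (step vs ws)
  have "edge [Node (vs @ [c])] [Node (ws @ [c])]"
    using edge_Node[OF inner_edge_butlast[OF step(2)], where fs = "[]" and gs = "[]"] by simp
  with step.IH show ?case by (rule rtranclp.rtrancl_into_rtrancl)
qed simp

text \<open>The first tree is never itself moved: an edge grafts onto \<open>d\<close>, works inside
  it through an inner edge, or leaves it alone. All this remains possible when \<open>d\<close> is a
  last child, which is frozen in place but may change within.\<close>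

lemma edge_lift:
  assumes "edge (d # ss) w"
  obtains d' ss' where "w = d' # ss'" "edge (Node (ls @ [d]) # ss) (Node (ls @ [d']) # ss')"
  using assms
proof (cases rule: edge.cases)
  case (edge_graft t x t' fs gs)
  show ?thesis
  proof (cases fs)
    case Nil
    then show ?thesis
      using that[of t' gs] edge_graft
        edge_inner_edge.edge_graft[OF graft_last[of t x t' ls], of "[]" gs] by simp
  next
    case (Cons d' fs')
    then show ?thesis
      using that[of d "fs' @ [t'] @ gs"] edge_graft
        edge_inner_edge.edge_graft[of t x t' "Node (ls @ [d]) # fs'" gs] by simp
  qed
next
  case (edge_Node ts ts' fs gs)
  show ?thesis
  proof (cases fs)
    case Nil
    then show ?thesis
      using that[of "Node ts'" gs] edge_Node
        edge_inner_edge.edge_Node[OF inner_edge_last[of ts ts' ls], of "[]" gs] by simp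
  next
    case (Cons d' fs')
    then show ?thesis
      using that[of d "fs' @ [Node ts'] @ gs"] edge_Node
        edge_inner_edge.edge_Node[of ts ts' "Node (ls @ [d]) # fs'" gs] by simp
  qed
qed

lemma edge_rtranclp_lift:
  assumes "edge\<^sup>*\<^sup>* (d # ss) w"
  shows "\<exists>d' ss'. w = d' # ss' \<and> edge\<^sup>*\<^sup>* (Node (ls @ [d]) # ss) (Node (ls @ [d']) # ss')"
  using assms
proof (induction rule: rtranclp_induct)
  case (step v w)
  then obtain d' ss' where v: "v = d' # ss'" "edge\<^sup>*\<^sup>* (Node (ls @ [d]) # ss) (Node (ls @ [d']) # ss')"
    by blast
  from step(2) obtain d'' ss'' where "w = d'' # ss''" "edge (Node (ls @ [d']) # ss') (Node (ls @ [d'']) # ss'')"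
    unfolding v(1) by (rule edge_lift)
  then show ?case using v(2) by (blast intro: rtranclp.rtrancl_into_rtrancl)
qed blast

lemma below_imp_edge_rtranclp: "below us ts \<Longrightarrow> edge\<^sup>*\<^sup>* us ts"
  and below_tree_imp_edge_rtranclp: "below_tree us t \<Longrightarrow> edge\<^sup>*\<^sup>* us [t]"
proof (induction rule: below_below_tree.inducts)
  case (below_Cons us t vs ts)
  then show ?case
    using edge_rtranclp_context[of us "[t]" "[]" vs] edge_rtranclp_context[of vs ts "[t]" "[]"] by simp
next
  case (below_tree_Node ls gs rs c b)
  show ?case
  proof (cases "b \<le> length ls")
    case True
    \<comment> \<open>The cut falls within \<open>ls\<close>: first \<open>rs\<close> becomes
      \<open>c\<close> at ground level, then everything is grafted under the first root, and only
      then do the trees before \<open>c\<close> become \<open>gs\<close>.\<close>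
    have "edge\<^sup>*\<^sup>* (Node (take b ls) # drop b ls @ rs) (Node (take b ls) # drop b ls @ [c])"
      using edge_rtranclp_context[OF below_tree_Node.IH(2), of "Node (take b ls) # drop b ls" "[]"] by simp
    also have "edge\<^sup>*\<^sup>* (Node (take b ls) # drop b ls @ [c]) [Node (ls @ [c])]"
      using edge_rtranclp_absorb[of "take b ls" "drop b ls @ [c]"] by (simp flip: append_assoc)
    also have "edge\<^sup>*\<^sup>* [Node (ls @ [c])] [Node (gs @ [c])]"
      using edge_rtranclp_butlast below_tree_Node.IH(1) by blast
    finally show ?thesis using True by simp
  next
    case False
    with below_tree_Node.hyps(3) have b: "b = Suc (length ls)" by simp
    obtain d ss where rs: "rs = d # ss" using below_tree_not_Nil[OF below_tree_Node.hyps(2)] by (cases rs) auto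
    \<comment> \<open>The first tree of \<open>rs\<close> already is the last child, so the path
      from \<open>rs\<close> to \<open>c\<close> is carried out with that tree under the
      root.\<close>
    have "edge\<^sup>*\<^sup>* (Node (ls @ [d]) # ss) [Node (ls @ [c])]"
      using edge_rtranclp_lift[of d ss "[c]" ls] below_tree_Node.IH(2) rs by auto
    also have "edge\<^sup>*\<^sup>* [Node (ls @ [c])] [Node (gs @ [c])]"
      using edge_rtranclp_butlast below_tree_Node.IH(1) by blast
    finally show ?thesis by (simp add: b rs)
  qed
qed auto

lemma edge_rtranclp_iff_below: "edge\<^sup>*\<^sup>* us ts \<longleftrightarrow> below us ts"
  using edge_rtranclp_imp_below below_imp_edge_rtranclp by blast

definition below_pairs :: "nat \<Rightarrow> (plane_tree list \<times> plane_tree list) set" where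
  "below_pairs n = {(us, ts). below us ts \<and> fsize ts = n}"

lemma dexter_intervals_eq: "dexter_intervals n = map_prod word word ` below_pairs n"
proof -
  have "dexter_le n u v \<longleftrightarrow> (\<exists>us ts. u = word us \<and> v = word ts \<and> below us ts \<and> fsize ts = n)" for u v
    unfolding dexter_le_def dyck_eq_word_image
    using fsize_below by (force simp: dexter_edges_rtrancl_word edge_rtranclp_iff_below word_inject)
  moreover have "dexter_intervals n = {(u, v). dexter_le n u v}"
    by (auto simp: dexter_intervals_def dexter_le_def)
  ultimately show ?thesis by (force simp: below_pairs_def)
qed

lemma card_dexter_intervals: "card (dexter_intervals n) = card (below_pairs n)"
proof -
  have "inj word" by (simp add: inj_def word_inject)
  then show ?thesis unfolding dexter_intervals_eq
    by (intro card_image inj_on_subset[OF map_prod_inj_on[of word UNIV word UNIV]]) auto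
qed

subsection \<open>Counting intervals\<close>

definition below_tree_pairs :: "nat \<Rightarrow> (plane_tree list \<times> plane_tree) set" where
  "below_tree_pairs n = {(us, t). below_tree us t \<and> fsize [t] = n}"

lemma finite_fsize: "finite {fs. fsize fs = n}"
proof (rule finite_imageD)
  have "word ` {fs. fsize fs = n} \<subseteq> {w. set w \<subseteq> UNIV \<and> length w = 2 * n}" by auto
  then show "finite (word ` {fs. fsize fs = n})"
    by (rule finite_subset) (rule finite_lists_length_eq, simp)
qed (simp add: inj_on_def word_inject)

lemma finite_below_pairs [simp]: "finite (below_pairs n)"
proof (rule finite_subset)
  show "below_pairs n \<subseteq> {fs. fsize fs = n} \<times> {fs. fsize fs = n}"
    by (auto simp: below_pairs_def fsize_below)
qed (simp add: finite_fsize)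

lemma finite_below_tree_pairs [simp]: "finite (below_tree_pairs n)"
proof (rule finite_imageD)
  have "map_prod id (\<lambda>t. [t]) ` below_tree_pairs n \<subseteq> below_pairs n"
    by (auto simp: below_pairs_def below_tree_pairs_def below_singleton_iff)
  then show "finite (map_prod id (\<lambda>t. [t]) ` below_tree_pairs n)"
    by (rule finite_subset) simp
qed (auto simp: inj_on_def)

lemma below_tree_pairs_0 [simp]: "below_tree_pairs 0 = {}"
  by (auto simp: below_tree_pairs_def)

lemma below_Nil_iff: "below us [] \<longleftrightarrow> us = []"
  using below_Nil by (auto elim: below.cases)

lemma below_pairs_0: "below_pairs 0 = {([], [])}"
  by (auto simp: below_pairs_def below_Nil_iff)

lemma below_tree_leaf_iff: "below_tree us (Node []) \<longleftrightarrow> us = [Node []]"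
  using below_tree_leaf by (auto elim: below_tree.cases)

lemma below_tree_pairs_1: "below_tree_pairs (Suc 0) = {([Node []], Node [])}"
proof -
  have "fsize [t] = Suc 0 \<longleftrightarrow> t = Node []" for t by (cases t) simp
  then show ?thesis by (auto simp: below_tree_pairs_def below_tree_leaf_iff)
qed

text \<open>Trees have positive size, so a prefix of a forest is determined by its size. In the
  bijections below that size is read off the upper end.\<close>

lemma append_fsize_cancel: "us @ vs = us' @ vs' \<Longrightarrow> fsize us = fsize us' \<Longrightarrow> us = us' \<and> vs = vs'"
  by (auto simp: append_eq_append_conv2)

lemma bij_betw_below_pairs:
  assumes "0 < n"
  shows "bij_betw (\<lambda>(m, (us, t), (vs, ts)). (us @ vs, t # ts))
    (SIGMA m:{0..n}. below_tree_pairs m \<times> below_pairs (n - m)) (below_pairs n)"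
    (is "bij_betw ?f ?A _")
proof (rule bij_betw_imageI)
  show "inj_on ?f ?A"
    by (auto simp: inj_on_def below_tree_pairs_def below_pairs_def dest: append_fsize_cancel fsize_below_tree)
      (metis append_fsize_cancel fsize_below_tree)+
  show "?f ` ?A = below_pairs n"
  proof (intro equalityI subsetI)
    fix p assume "p \<in> ?f ` ?A"
    then obtain m us t vs ts where p: "p = (us @ vs, t # ts)" "m \<le> n" "(us, t) \<in> below_tree_pairs m"
      "(vs, ts) \<in> below_pairs (n - m)" by auto
    then show "p \<in> below_pairs n"
      using fsize_Cons[of t ts] by (simp add: below_pairs_def below_tree_pairs_def below_Cons)
  next
    fix p assume "p \<in> below_pairs n"
    then obtain ws ts where p: "p = (ws, ts)" "below ws ts" "fsize ts = n" by (auto simp: below_pairs_def)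
    from p(2) show "p \<in> ?f ` ?A"
    proof (cases rule: below.cases)
      case (below_Cons us t vs ts')
      have "(fsize [t], (us, t), (vs, ts')) \<in> ?A"
        using below_Cons p fsize_Cons[of t ts'] by (simp add: below_pairs_def below_tree_pairs_def)
      then show ?thesis using p below_Cons by (force intro: rev_image_eqI)
    qed (use p assms in simp)
  qed
qed

text \<open>The upper end gives \<open>gs\<close> and \<open>c\<close>, the lower end gives
  \<open>ls @ rs\<close>, and the size of \<open>gs\<close> locates the border between
  \<open>ls\<close> and \<open>rs\<close>. For positive \<open>n\<close> the leaf rule cannot
  occur.\<close>

lemma bij_betw_below_tree_pairs:
  assumes "0 < n"
  shows "bij_betw (\<lambda>(m, ((ls, gs), (rs, c)), b). (Node (take b (ls @ rs)) # drop b (ls @ rs), Node (gs @ [c])))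
    (SIGMA m:{0..n}. SIGMA p:below_pairs m \<times> below_tree_pairs (n - m). {..Suc (length (fst (fst p)))})
    (below_tree_pairs (Suc n))"
    (is "bij_betw ?f ?A _")
proof (rule bij_betw_imageI)
  show "inj_on ?f ?A"
  proof (rule inj_onI)
    fix x x' assume x: "x \<in> ?A" "x' \<in> ?A" "?f x = ?f x'"
    obtain m ls gs rs c b where X: "x = (m, ((ls, gs), (rs, c)), b)" by (metis prod.exhaust)
    obtain m' ls' gs' rs' c' b' where X': "x' = (m', ((ls', gs'), (rs', c')), b')" by (metis prod.exhaust)
    have g: "gs = gs'" "c = c'" using x(3) by (auto simp: X X')
    have td: "take b (ls @ rs) = take b' (ls' @ rs')" "drop b (ls @ rs) = drop b' (ls' @ rs')"
      using x(3) by (simp_all add: X X' del: take_append drop_append)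
    then have "ls @ rs = ls' @ rs'" by (metis append_take_drop_id)
    moreover have f: "fsize ls = m" "fsize gs = m" "fsize ls' = m'" "fsize gs' = m'"
      using x(1,2) fsize_below by (auto simp: X X' below_pairs_def)
    moreover have m: "m = m'" using f g by simp
    ultimately have l: "ls = ls'" "rs = rs'" using append_fsize_cancel[of ls rs ls' rs'] by simp_all
    \<comment> \<open>Since \<open>rs\<close> is nonempty, \<open>b\<close> never exceeds the length
      of \<open>ls @ rs\<close> and can be read off as the length of
      \<open>take b (ls @ rs)\<close>.\<close>
    have "rs \<noteq> []" using x(1) below_tree_not_Nil by (auto simp: X below_tree_pairs_def)
    then have "0 < length rs" by simp
    moreover have "b \<le> Suc (length ls)" "b' \<le> Suc (length ls)" using x(1,2) l by (auto simp: X X')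
    ultimately have "b \<le> length (ls @ rs)" "b' \<le> length (ls @ rs)" unfolding length_append by linarith+
    then have "b = b'" using arg_cong[OF td(1), of length] l by (simp add: min_def split: if_splits)
    then show "x = x'" using g l m by (simp add: X X')
  qed
  show "?f ` ?A = below_tree_pairs (Suc n)"
  proof (intro equalityI subsetI)
    fix p assume "p \<in> ?f ` ?A"
    then obtain m ls gs rs c b where p: "p = ?f (m, ((ls, gs), (rs, c)), b)"
      "(ls, gs) \<in> below_pairs m" "(rs, c) \<in> below_tree_pairs (n - m)" "m \<le> n" "b \<le> Suc (length ls)"
      by auto
    then show "p \<in> below_tree_pairs (Suc n)"
      using below_tree_Node[of ls gs rs c b] by (simp add: below_pairs_def below_tree_pairs_def del: take_append drop_append)
  next
    fix p assume "p \<in> below_tree_pairs (Suc n)"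
    then obtain ws t where p: "p = (ws, t)" "below_tree ws t" "fsize [t] = Suc n"
      by (auto simp: below_tree_pairs_def)
    from p(2) show "p \<in> ?f ` ?A"
    proof (cases rule: below_tree.cases)
      case (below_tree_Node ls gs rs c b)
      then have "p = ?f (fsize gs, ((ls, gs), (rs, c)), b)" using p by simp
      moreover have "(fsize gs, ((ls, gs), (rs, c)), b) \<in> ?A"
        using below_tree_Node p by (simp add: below_pairs_def below_tree_pairs_def)
      ultimately show ?thesis by (rule image_eqI)
    qed (use p assms in simp)
  qed
qed

section \<open>Generating functions with a catalytic variable\<close>

abbreviation catalytic :: "real poly" where
  "catalytic \<equiv> [:0, 1:]"

text \<open>This is J, and \<open>tree_interval_gf\<close> is K; \<open>catalytic\<close> is y and
  the series variable is t. With polynomial coefficients, setting y = 1 is a coefficientwise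
  evaluation and y - 1 can be cancelled.\<close>

definition interval_gf :: "real poly fps" where
  "interval_gf = Abs_fps (\<lambda>n. \<Sum>(us, ts)\<in>below_pairs n. catalytic ^ length us)"

definition tree_interval_gf :: "real poly fps" where
  "tree_interval_gf = Abs_fps (\<lambda>n. \<Sum>(us, t)\<in>below_tree_pairs n. catalytic ^ length us)"

lemma interval_gf_nth: "fps_nth interval_gf n = (\<Sum>p\<in>below_pairs n. catalytic ^ length (fst p))"
  by (simp add: interval_gf_def case_prod_beta)

lemma tree_interval_gf_nth:
  "fps_nth tree_interval_gf n = (\<Sum>p\<in>below_tree_pairs n. catalytic ^ length (fst p))"
  by (simp add: tree_interval_gf_def case_prod_beta)

lemma poly_interval_gf: "poly (fps_nth interval_gf n) 1 = real (card (below_pairs n))"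
  by (simp add: interval_gf_nth poly_sum poly_power)

lemma interval_gf_eq: "interval_gf = 1 + tree_interval_gf * interval_gf"
proof (rule fps_ext)
  fix n
  show "fps_nth interval_gf n = fps_nth (1 + tree_interval_gf * interval_gf) n"
  proof (cases "n = 0")
    case True
    then show ?thesis by (simp add: interval_gf_nth tree_interval_gf_nth below_pairs_0)
  next
    case False
    have "fps_nth interval_gf n =
      (\<Sum>(m, (us, t), (vs, ts))\<in>(SIGMA m:{0..n}. below_tree_pairs m \<times> below_pairs (n - m)).
        catalytic ^ length us * catalytic ^ length vs)"
      unfolding interval_gf_nth using False
      by (subst sum.reindex_bij_betw[OF bij_betw_below_pairs, symmetric])
        (auto intro!: sum.cong simp: power_add)
    also have "\<dots> = (\<Sum>m=0..n. \<Sum>p\<in>below_tree_pairs m \<times> below_pairs (n - m).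
        catalytic ^ length (fst (fst p)) * catalytic ^ length (fst (snd p)))"
      by (subst sum.Sigma) (auto simp: case_prod_beta)
    also have "\<dots> = (\<Sum>m=0..n. fps_nth tree_interval_gf m * fps_nth interval_gf (n - m))"
      by (simp add: interval_gf_nth tree_interval_gf_nth sum_product sum.cartesian_product case_prod_beta)
    finally show ?thesis using False by (simp add: fps_mult_nth)
  qed
qed

text \<open>With \<open>l\<close> and \<open>r\<close> the lengths of \<open>ls\<close> and
  \<open>rs\<close>, a cut after \<open>b\<close> trees gives a lower end of
  \<open>Suc (l + r - b)\<close> trees. The sum is geometric, with exponents from \<open>r\<close>
  to \<open>l + r + 1\<close>; as \<open>r\<close> is positive, the subtraction never
  truncates.\<close>

lemma catalytic_sum:
  assumes "0 < r"
  shows "(catalytic - 1) * (\<Sum>b\<le>Suc l. catalytic ^ Suc (l + r - b)) = catalytic ^ r * (catalytic ^ (l + 2) - 1)"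
proof -
  have "(\<Sum>b\<le>Suc l. catalytic ^ Suc (l + r - b)) = (\<Sum>b\<le>Suc l. catalytic ^ r * catalytic ^ (Suc l - b))"
  proof (intro sum.cong refl)
    fix b assume "b \<in> {..Suc l}"
    then have "Suc (l + r - b) = r + (Suc l - b)" using assms by auto
    then show "catalytic ^ Suc (l + r - b) = catalytic ^ r * catalytic ^ (Suc l - b)"
      by (simp only: power_add)
  qed
  also have "\<dots> = catalytic ^ r * (\<Sum>b\<le>Suc l. catalytic ^ b)"
    using sum.nat_diff_reindex[of "\<lambda>b. catalytic ^ b" "Suc (Suc l)"]
    by (simp only: lessThan_Suc_atMost diff_Suc_Suc flip: sum_distrib_left)
  finally show ?thesis
    using power_diff_1_eq[of catalytic "Suc (Suc l)"] by (simp add: lessThan_Suc_atMost mult.left_commute)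
qed

lemma tree_interval_gf_Suc:
  assumes "0 < n"
  shows "(catalytic - 1) * fps_nth tree_interval_gf (Suc n) =
    (\<Sum>m=0..n. (catalytic ^ 2 * fps_nth interval_gf m - [:poly (fps_nth interval_gf m) 1:]) *
      fps_nth tree_interval_gf (n - m))"
proof -
  let ?S = "\<lambda>m. below_pairs m \<times> below_tree_pairs (n - m)"
  let ?l = "\<lambda>p :: (plane_tree list \<times> plane_tree list) \<times> (plane_tree list \<times> plane_tree). length (fst (fst p))"
  let ?r = "\<lambda>p :: (plane_tree list \<times> plane_tree list) \<times> (plane_tree list \<times> plane_tree). length (fst (snd p))"
  have "fps_nth tree_interval_gf (Suc n) =
    (\<Sum>(m, p, b)\<in>(SIGMA m:{0..n}. SIGMA p:?S m. {..Suc (?l p)}). catalytic ^ Suc (?l p + ?r p - b))"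
    unfolding tree_interval_gf_nth
    by (subst sum.reindex_bij_betw[OF bij_betw_below_tree_pairs[OF assms], symmetric])
      (auto intro!: sum.cong simp del: power_Suc take_append drop_append)
  also have "\<dots> = (\<Sum>m=0..n. \<Sum>(p, b)\<in>(SIGMA p:?S m. {..Suc (?l p)}). catalytic ^ Suc (?l p + ?r p - b))"
    by (subst sum.Sigma) (auto simp: case_prod_beta)
  also have "\<dots> = (\<Sum>m=0..n. \<Sum>p\<in>?S m. \<Sum>b\<le>Suc (?l p). catalytic ^ Suc (?l p + ?r p - b))"
    by (intro sum.cong refl, subst sum.Sigma) (auto simp: case_prod_beta)
  finally have "(catalytic - 1) * fps_nth tree_interval_gf (Suc n) =
    (\<Sum>m=0..n. \<Sum>p\<in>?S m. (catalytic - 1) * (\<Sum>b\<le>Suc (?l p). catalytic ^ Suc (?l p + ?r p - b)))"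
    by (simp only: sum_distrib_left)
  \<comment> \<open>The geometric sum separates \<open>l\<close> from \<open>r\<close>, so the sum
    over pairs of intervals becomes a product. The term -1 counts all intervals, which yields J at y
    = 1.\<close>
  also have "\<dots> = (\<Sum>m=0..n. \<Sum>p\<in>?S m. (catalytic ^ 2 * catalytic ^ ?l p - 1) * catalytic ^ ?r p)"
  proof (intro sum.cong refl)
    fix m p assume "p \<in> ?S m"
    then have "0 < ?r p" using below_tree_not_Nil by (auto simp: below_tree_pairs_def)
    from catalytic_sum[OF this, of "?l p"]
    show "(catalytic - 1) * (\<Sum>b\<le>Suc (?l p). catalytic ^ Suc (?l p + ?r p - b)) =
      (catalytic ^ 2 * catalytic ^ ?l p - 1) * catalytic ^ ?r p"
      by (simp only: power_add mult_ac)
  qed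
  also have "\<dots> = (\<Sum>m=0..n. (\<Sum>p\<in>below_pairs m. catalytic ^ 2 * catalytic ^ length (fst p) - 1) *
      (\<Sum>q\<in>below_tree_pairs (n - m). catalytic ^ length (fst q)))"
    by (simp only: sum_product sum.cartesian_product split_def)
  also have "\<dots> = (\<Sum>m=0..n. (catalytic ^ 2 * fps_nth interval_gf m - [:poly (fps_nth interval_gf m) 1:]) *
      fps_nth tree_interval_gf (n - m))"
  proof -
    have "(\<Sum>p\<in>below_pairs m. catalytic ^ 2 * catalytic ^ length (fst p) - 1) =
      catalytic ^ 2 * fps_nth interval_gf m - [:poly (fps_nth interval_gf m) 1:]" for m
      unfolding poly_interval_gf
      by (simp add: sum_subtractf interval_gf_nth sum_distrib_left of_nat_poly)
    then show ?thesis by (simp only: tree_interval_gf_nth)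
  qed
  finally show ?thesis .
qed

subsection \<open>Solving the functional equation\<close>

fun catalan :: "nat \<Rightarrow> nat" where
  "catalan 0 = 1"
| "catalan (Suc n) = (\<Sum>i\<le>n. catalan i * catalan (n - i))"

text \<open>A device for solving quadratics: composed with a series a without constant term it
  yields c with c = 1 + a c^2. It is applied over the reals to 2 t and over polynomials to q
  y.\<close>

definition catalan_gf :: "'a::idom fps" where
  "catalan_gf = Abs_fps (\<lambda>n. of_nat (catalan n))"

lemma catalan_gf_eq: "(catalan_gf :: 'a::idom fps) = 1 + fps_X * catalan_gf ^ 2"
proof (rule fps_ext)
  fix n
  have "fps_nth ((catalan_gf :: 'a fps) ^ 2) m = of_nat (catalan (Suc m))" for m
    by (simp add: catalan_gf_def power2_eq_square fps_mult_nth atMost_atLeast0)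
  then show "fps_nth (catalan_gf :: 'a fps) n = fps_nth (1 + fps_X * catalan_gf ^ 2) n"
    by (cases n) (simp_all add: catalan_gf_def)
qed

lemma catalan_gf_compose:
  fixes a :: "'a::idom fps"
  assumes "fps_nth a 0 = 0"
  shows "catalan_gf oo a = 1 + a * (catalan_gf oo a) ^ 2"
proof -
  have "catalan_gf oo a = (1 + fps_X * catalan_gf ^ 2) oo a"
    by (subst catalan_gf_eq) simp
  also have "\<dots> = 1 + a * (catalan_gf oo a) ^ 2"
    using assms by (simp add: fps_compose_add_distrib fps_compose_mult_distrib power2_eq_square)
  finally show ?thesis .
qed

section \<open>Series free of y, and setting y = 1\<close>

definition const_coeffs :: "real fps \<Rightarrow> real poly fps" where
  "const_coeffs f = Abs_fps (\<lambda>n. [:fps_nth f n:])"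

definition at_one :: "real poly fps \<Rightarrow> real fps" where
  "at_one f = Abs_fps (\<lambda>n. poly (fps_nth f n) 1)"

lemma const_poly_sum: "[:\<Sum>i\<in>A. f i:] = (\<Sum>i\<in>A. [:f i:])"
proof (induction A rule: infinite_finite_induct)
  case (insert x F)
  then show ?case by (simp flip: insert.IH)
qed simp_all

text \<open>\<open>const_coeffs\<close> carries identities about z into series over polynomials;
  \<open>at_one\<close> will specialise the functional equation.\<close>

lemma const_coeffs_simps:
  "const_coeffs (f + g) = const_coeffs f + const_coeffs g"
  "const_coeffs (f - g) = const_coeffs f - const_coeffs g"
  "const_coeffs (f * g) = const_coeffs f * const_coeffs g"
  "const_coeffs 1 = 1"
  "const_coeffs fps_X = fps_X"
  by (simp_all add: fps_eq_iff const_coeffs_def fps_mult_nth const_poly_sum fps_X_def mult.commute)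

lemma at_one_simps:
  "at_one (f + g) = at_one f + at_one g"
  "at_one (f - g) = at_one f - at_one g"
  "at_one (f * g) = at_one f * at_one g"
  "at_one 1 = 1"
  "at_one 0 = 0"
  "at_one fps_X = fps_X"
  "at_one (fps_const catalytic) = 1"
  "at_one (const_coeffs h) = h"
  by (simp_all add: fps_eq_iff at_one_def const_coeffs_def fps_mult_nth poly_sum fps_X_def)

lemma const_coeffs_power: "const_coeffs (f ^ n) = const_coeffs f ^ n"
  by (induction n) (simp_all add: const_coeffs_simps)

lemma at_one_power: "at_one (f ^ n) = at_one f ^ n"
  by (induction n) (simp_all add: at_one_simps)

text \<open>Multiplying the equation of K by J and using K J = J - 1 gives an equation in J alone,
  with t times this on the right. J(1) is a separate argument so that a candidate for it can be
  inserted.\<close>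

definition catalytic_rhs :: "real poly fps \<Rightarrow> real fps \<Rightarrow> real poly fps" where
  "catalytic_rhs f a = fps_const catalytic * (fps_const catalytic - 1) * f +
     (f - 1) * (fps_const catalytic ^ 2 * f - const_coeffs a)"

lemma fps_mult_nth_cong:
  assumes "\<And>k. k \<le> n \<Longrightarrow> fps_nth f k = fps_nth f' k" "\<And>k. k \<le> n \<Longrightarrow> fps_nth g k = fps_nth g' k"
  shows "fps_nth (f * g) n = fps_nth (f' * g') n"
  unfolding fps_mult_nth using assms by (intro sum.cong) auto

text \<open>The factor \<open>fps_X\<close> makes coefficient n on the right depend on earlier
  coefficients only, also through \<open>at_one\<close>. On the left the unknown is multiplied by y
  - 1, which cancels in the polynomial ring.\<close>

lemma catalytic_equation_unique:
  assumes f: "(fps_const catalytic - 1) * (f - 1) = fps_X * catalytic_rhs f (at_one f)"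
    and g: "(fps_const catalytic - 1) * (g - 1) = fps_X * catalytic_rhs g (at_one g)"
  shows "f = g"
proof (rule fps_ext)
  fix n
  show "fps_nth f n = fps_nth g n"
  proof (induction n rule: less_induct)
    case (less n)
    have "fps_nth (fps_X * catalytic_rhs f (at_one f)) n = fps_nth (fps_X * catalytic_rhs g (at_one g)) n"
    proof (cases n)
      case (Suc m)
      have eq: "fps_nth f k = fps_nth g k" if "k \<le> m" for k using less Suc that by simp
      have "fps_nth (catalytic_rhs f (at_one f)) m = fps_nth (catalytic_rhs g (at_one g)) m"
        unfolding catalytic_rhs_def fps_add_nth
        by (intro arg_cong2[where f = "(+)"] fps_mult_nth_cong)
          (simp_all add: eq const_coeffs_def at_one_def cong: fps_mult_nth_cong)
      then show ?thesis by (simp add: Suc)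
    qed simp
    then have "fps_nth ((fps_const catalytic - 1) * (f - 1)) n = fps_nth ((fps_const catalytic - 1) * (g - 1)) n"
      unfolding f g .
    moreover have "fps_nth ((fps_const catalytic - 1) * h) n = (catalytic - 1) * fps_nth h n" for h
      by (simp add: left_diff_distrib)
    moreover have "catalytic - 1 \<noteq> 0" by (simp add: one_pCons)
    ultimately have "fps_nth (f - 1) n = fps_nth (g - 1) n" by (metis mult_left_cancel)
    then show ?case by simp
  qed
qed

text \<open>\<open>X\<close>, \<open>Y\<close>, \<open>Z\<close> stand for t, y, z; the inverses
  \<open>I\<close> and \<open>D\<close> are given by equations, so that everything is polynomial
  algebra in a domain. \<open>W\<close> is the candidate for J and \<open>A\<close> the one for
  J(1).\<close>

lemma catalytic_solution:
  fixes X Y Z I D c :: "'a::idom"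
  assumes X: "X = Z * (1 - 2 * Z)" and I: "I * (1 - Z) = 1" and D: "D * (1 - 2 * Z) = 1"
    and c: "c = 1 + X * I ^ 2 * Y * c ^ 2" and "c \<noteq> 0"
  defines "W \<equiv> c * (1 - Z * c) * I" and "A \<equiv> (1 - 3 * Z + Z ^ 2) * D ^ 2"
  shows "(Y - 1) * (W - 1) = X * (Y * (Y - 1) * W + (W - 1) * (Y ^ 2 * W - A))"
proof -
  define g where "g = X * I ^ 2 * Y"
  have gc: "g * c ^ 2 = c - 1" using c unfolding g_def by (metis add_diff_cancel_left')
  have XA: "X * A = 1 - (1 - Z) ^ 3 * D"
  proof -
    have "X * A = (D * (1 - 2 * Z)) * (Z * (1 - 3 * Z + Z ^ 2) * D)"
      unfolding A_def X by algebra
    also have "\<dots> = Z * (1 - 3 * Z + Z ^ 2) * D"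
      unfolding D by simp
    also have "\<dots> = D * (1 - 2 * Z) - (1 - Z) ^ 3 * D"
      by algebra
    finally show ?thesis unfolding D .
  qed
  have YZ: "(c - 1) * (1 - Z) ^ 2 * D = Y * Z * c ^ 2"
  proof -
    have "(c - 1) * (1 - Z) ^ 2 * D = (I * (1 - Z)) ^ 2 * (D * (1 - 2 * Z)) * (Y * Z * c ^ 2)"
      unfolding gc[symmetric] g_def X by algebra
    then show ?thesis unfolding I D by simp
  qed
  \<comment> \<open>The terms of the equation are expressed through \<open>c\<close> and
    \<open>Z\<close>; \<open>S2\<close> carries a factor \<open>c\<close> to avoid dividing by
    it.\<close>
  have S1: "X * Y ^ 2 * W ^ 2 = Y * (c - 1) * (1 - Z * c) ^ 2"
    unfolding gc[symmetric] g_def W_def by algebra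
  have S2: "c * (X * Y * W) = (1 - Z) * (c - 1) * (1 - Z * c)"
  proof -
    have "(1 - Z) * (c - 1) * (1 - Z * c) = (I * (1 - Z)) * (c * (X * Y * W))"
      unfolding gc[symmetric] g_def W_def by algebra
    then show ?thesis unfolding I by simp
  qed
  have S3: "W - 1 = I * (c - 1) * (1 - Z - Z * c)"
  proof -
    have "W - I * (1 - Z) = I * (c - 1) * (1 - Z - Z * c)"
      unfolding W_def by algebra
    then show ?thesis unfolding I .
  qed
  \<comment> \<open>Chosen so that the terms with \<open>Y\<close> combine into a multiple of Y Z
    c^2, which \<open>YZ\<close> replaces by an expression without \<open>Y\<close>.\<close>
  define u where "u = 1 - 2 * Z - Z * c * (1 - Z)"
  have S4: "(1 - Z * c) ^ 2 = I * (1 - Z - Z * c) - I * (Z * c) * u"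
  proof -
    have "(I * (1 - Z)) * (1 - Z * c) ^ 2 = I * (1 - Z - Z * c) - I * (Z * c) * u"
      unfolding u_def by algebra
    then show ?thesis unfolding I by simp
  qed
  have S5: "Y * (1 - Z * c) ^ 2 * c - Y * I * (1 - Z - Z * c) * c = - (I * u * ((c - 1) * (1 - Z) ^ 2 * D))"
    unfolding YZ S4 by algebra
  \<comment> \<open>By \<open>XA\<close> this is X A + Y - 1, the factor of W - 1 once the equation
    is collected.\<close>
  define M where "M = Y - (1 - Z) ^ 3 * D"
  have "c * (X * Y ^ 2 * W ^ 2 - X * Y * W - M * (W - 1)) =
    c * (Y * (c - 1) * (1 - Z * c) ^ 2) - (1 - Z) * (c - 1) * (1 - Z * c) - c * M * (I * (c - 1) * (1 - Z - Z * c))"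
    unfolding right_diff_distrib[of c] S1 S2 S3 by (simp only: mult.assoc)
  also have "\<dots> = (c - 1) * ((Y * (1 - Z * c) ^ 2 * c - Y * I * (1 - Z - Z * c) * c)
      - (1 - Z) * (1 - Z * c) + (I * (1 - Z)) * (1 - Z) ^ 2 * D * (1 - Z - Z * c) * c)"
    unfolding M_def by algebra
  also have "\<dots> = (c - 1) * (- ((I * (1 - Z)) * u * (c - 1) * (1 - Z) * D)
      - (1 - Z) * (1 - Z * c) * 1 + (I * (1 - Z)) * (1 - Z) ^ 2 * D * (1 - Z - Z * c) * c)"
    unfolding S5 by algebra
  \<comment> \<open>The middle term now carries 1 = D (1 - 2 Z), so that \<open>D\<close> factors
    out and a polynomial identity in \<open>c\<close> and \<open>Z\<close> remains.\<close>
  also have "\<dots> = (c - 1) * (- (u * (c - 1) * (1 - Z) * D)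
      - (1 - Z) * (1 - Z * c) * (D * (1 - 2 * Z)) + (1 - Z) ^ 2 * D * (1 - Z - Z * c) * c)"
    unfolding I D by simp
  also have "\<dots> = 0" unfolding u_def by algebra
  finally have 0: "X * Y ^ 2 * W ^ 2 - X * Y * W - M * (W - 1) = 0" using \<open>c \<noteq> 0\<close> by simp
  have M: "M = X * A + Y - 1" unfolding M_def XA by simp
  have "(Y - 1) * (W - 1) - X * (Y * (Y - 1) * W + (W - 1) * (Y ^ 2 * W - A)) =
      - (X * Y ^ 2 * W ^ 2 - X * Y * W - M * (W - 1))"
    unfolding M by algebra
  then show ?thesis unfolding 0 by simp
qed

text \<open>The power series z with t = z - 2 z^2. The name recalls that the final numbers, for n at
  least 1, count rooted bicubic planar maps with 2 n vertices.\<close>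

definition bicubic_root :: "real fps" where
  "bicubic_root = fps_X * (catalan_gf oo (2 * fps_X))"

lemma bicubic_root_eq: "fps_X = bicubic_root * (1 - 2 * bicubic_root)"
proof -
  let ?c = "catalan_gf oo (2 * fps_X) :: real fps"
  have "?c = 1 + 2 * fps_X * ?c ^ 2" by (rule catalan_gf_compose) simp
  then show ?thesis unfolding bicubic_root_def by algebra
qed

lemma bicubic_root_nth_0 [simp]: "fps_nth bicubic_root 0 = 0"
  by (simp add: bicubic_root_def)

definition bicubic_gf :: "real fps" where
  "bicubic_gf = (1 - 3 * bicubic_root + bicubic_root ^ 2) * inverse (1 - 2 * bicubic_root) ^ 2"

lemma const_coeffs_numeral: "const_coeffs (numeral k) = numeral k"
  by (simp add: fps_eq_iff const_coeffs_def numeral_fps_const numeral_poly)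

text \<open>The explicit \<open>W\<close> solves the equation with \<open>bicubic_gf\<close> in the
  place of its own value at y = 1; uniqueness applies only after the two are shown to agree.\<close>

lemma catalytic_equation_at_one:
  assumes "(fps_const catalytic - 1) * (f - 1) = fps_X * catalytic_rhs f (at_one f)"
  shows "at_one f = bicubic_gf"
proof -
  let ?z = bicubic_root
  define Z where "Z = const_coeffs ?z"
  define I where "I = const_coeffs (inverse (1 - ?z))"
  define D where "D = const_coeffs (inverse (1 - 2 * ?z))"
  define Y :: "real poly fps" where "Y = fps_const catalytic"
  define c where "c = catalan_gf oo (fps_X * I ^ 2 * Y)"
  define W where "W = c * (1 - Z * c) * I"
  have X: "fps_X = Z * (1 - 2 * Z)"
    using arg_cong[OF bicubic_root_eq, of const_coeffs] by (simp add: const_coeffs_simps const_coeffs_numeral Z_def)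
  have I: "I * (1 - Z) = 1"
    using arg_cong[OF inverse_mult_eq_1[of "1 - ?z"], of const_coeffs] by (simp add: const_coeffs_simps const_coeffs_numeral Z_def I_def)
  have D: "D * (1 - 2 * Z) = 1"
    using arg_cong[OF inverse_mult_eq_1[of "1 - 2 * ?z"], of const_coeffs] by (simp add: const_coeffs_simps const_coeffs_numeral Z_def D_def)
  have c: "c = 1 + fps_X * I ^ 2 * Y * c ^ 2"
    unfolding c_def by (rule catalan_gf_compose) simp
  have "fps_nth c 0 = 1" by (subst c) (simp add: mult.assoc)
  then have "c \<noteq> 0" by auto
  have A: "const_coeffs bicubic_gf = (1 - 3 * Z + Z ^ 2) * D ^ 2"
    by (simp add: bicubic_gf_def const_coeffs_simps const_coeffs_numeral const_coeffs_power Z_def D_def)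
  have W: "(Y - 1) * (W - 1) = fps_X * (Y * (Y - 1) * W + (W - 1) * (Y ^ 2 * W - const_coeffs bicubic_gf))"
    unfolding A W_def by (rule catalytic_solution[OF X I D c \<open>c \<noteq> 0\<close>])
  \<comment> \<open>At y = 1 the left side and the first term on the right vanish, leaving a product
    equal to 0.\<close>
  have "at_one Y = 1" by (simp add: Y_def at_one_simps)
  then have "fps_X * ((at_one W - 1) * (at_one W - bicubic_gf)) = 0"
    using arg_cong[OF W, of at_one] by (simp add: at_one_simps at_one_power)
  \<comment> \<open>The other factor is excluded by the coefficient of t in \<open>W\<close>, which
    is y and hence 1 at y = 1.\<close>
  moreover have "at_one W \<noteq> 1"
  proof
    assume *: "at_one W = 1"
    have y: "catalytic - 1 \<noteq> 0" by (simp add: one_pCons)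
    have "fps_nth ((Y - 1) * (W - 1)) 0 = 0" unfolding W by simp
    then have W0: "fps_nth W 0 = 1" using y by (simp add: Y_def)
    have "fps_nth ((Y - 1) * (W - 1)) 1 = catalytic * (catalytic - 1)"
      unfolding W by (simp add: Y_def W0)
    moreover have "fps_nth ((Y - 1) * (W - 1)) 1 = (catalytic - 1) * fps_nth W 1"
      by (simp add: Y_def algebra_simps)
    ultimately have "fps_nth W 1 = catalytic" using y by (metis mult.commute mult_cancel_left)
    then have "fps_nth (at_one W) 1 = 1" by (simp add: at_one_def)
    then show False by (simp add: *)
  qed
  ultimately have W1: "at_one W = bicubic_gf" by simp
  have "f = W"
    using assms W unfolding W1[symmetric] catalytic_rhs_def[symmetric] Y_def
    by (rule catalytic_equation_unique)
  then show ?thesis using W1 by simp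
qed

section \<open>A differential equation for J(1) and its coefficients\<close>

lemma bicubic_gf_ode:
  "fps_X * (1 - 8 * fps_X) * fps_deriv bicubic_gf + (2 - 4 * fps_X) * bicubic_gf = 2 - fps_X"
proof -
  define z z' where "z = bicubic_root" and "z' = fps_deriv bicubic_root"
  define d where "d = inverse (1 - 2 * z)"
  have X: "fps_X = z * (1 - 2 * z)" using bicubic_root_eq by (simp add: z_def)
  have z': "(1 - 4 * z) * z' = 1"
    using arg_cong[OF X, of fps_deriv] by (simp add: z'_def algebra_simps flip: z_def)
  have d: "d * (1 - 2 * z) = 1" unfolding d_def by (rule inverse_mult_eq_1) (simp add: z_def)
  have d': "fps_deriv d * (1 - 2 * z) = 2 * d * z'"
    using arg_cong[OF d, of fps_deriv] by (simp add: z'_def algebra_simps flip: z_def)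
  have A: "bicubic_gf = (1 - 3 * z + z ^ 2) * d ^ 2"
    by (simp add: bicubic_gf_def z_def d_def)
  have dz: "fps_deriv z = z'" by (simp add: z_def z'_def)
  have "fps_deriv bicubic_gf = (2 * z - 3) * z' * d ^ 2 + (1 - 3 * z + z ^ 2) * 2 * d * fps_deriv d"
    unfolding A by (simp add: power2_eq_square dz) algebra
  then have "(1 - 2 * z) * fps_deriv bicubic_gf =
      (2 * z - 3) * z' * d * (d * (1 - 2 * z)) + (1 - 3 * z + z ^ 2) * 2 * d * (fps_deriv d * (1 - 2 * z))"
    by algebra
  then have A': "(1 - 2 * z) * fps_deriv bicubic_gf = z' * ((2 * z - 3) * d + 4 * (1 - 3 * z + z ^ 2) * d ^ 2)"
    unfolding d d' by algebra
  \<comment> \<open>From t = z (1 - 2 z) follows 1 - 8 t = (1 - 4 z)^2, which clears the denominator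
    of z' = 1 / (1 - 4 z).\<close>
  have "fps_X * (1 - 8 * fps_X) * fps_deriv bicubic_gf = z * (1 - 4 * z) ^ 2 * ((1 - 2 * z) * fps_deriv bicubic_gf)"
    unfolding X by algebra
  also have "\<dots> = z * (1 - 4 * z) * ((1 - 4 * z) * z') * ((2 * z - 3) * d * 1 + 4 * (1 - 3 * z + z ^ 2) * d ^ 2)"
    unfolding A' by algebra
  also have "\<dots> = z * (1 - 4 * z) * ((2 * z - 3) * d * (d * (1 - 2 * z)) + 4 * (1 - 3 * z + z ^ 2) * d ^ 2)"
    unfolding z' d by simp
  finally have "fps_X * (1 - 8 * fps_X) * fps_deriv bicubic_gf + (2 - 4 * fps_X) * bicubic_gf =
      (2 - fps_X) * (d * (1 - 2 * z)) ^ 2"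
    unfolding A X by algebra
  then show ?thesis unfolding d by simp
qed

lemma bicubic_gf_nth_0: "fps_nth bicubic_gf 0 = 1"
  by (simp add: bicubic_gf_def power2_eq_square)

text \<open>The correction at n = 1 comes from the term -t in the differential equation. It is why
  the closed form, which would give 3/4 at n = 0, begins at n = 1 only.\<close>

lemma bicubic_gf_rec:
  "real (n + 2) * fps_nth bicubic_gf n =
    (if n = 0 then 2 else (8 * real n - 4) * fps_nth bicubic_gf (n - 1) - (if n = 1 then 1 else 0))"
proof -
  have "fps_X * fps_deriv bicubic_gf - 8 * (fps_X * (fps_X * fps_deriv bicubic_gf))
     + 2 * bicubic_gf - 4 * (fps_X * bicubic_gf) = 2 - fps_X"
    using bicubic_gf_ode by algebra
  from arg_cong[OF this, of "\<lambda>f. fps_nth f n"] show ?thesis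
    by (cases n; cases "n - 1") (simp_all add: numeral_fps_const, simp_all add: algebra_simps)
qed

lemma bicubic_gf_nth:
  "fps_nth bicubic_gf (Suc n) = 3 * ((2 ^ n * fact (2 * Suc n)) / (fact (Suc n) * fact (n + 3)))"
proof (induction n)
  case 0
  show ?case using bicubic_gf_rec[of 1] bicubic_gf_nth_0 by (simp add: fact_numeral)
next
  case (Suc n)
  have "fps_nth bicubic_gf (Suc (Suc n)) = (8 * real n + 12) / (real n + 4) * fps_nth bicubic_gf (Suc n)"
    using bicubic_gf_rec[of "Suc (Suc n)"] by (simp add: field_simps)
  also have "\<dots> = 3 * ((2 ^ Suc n * fact (2 * Suc (Suc n))) / (fact (Suc (Suc n)) * fact (Suc n + 3)))"
    using fact_Suc[of "n + 3", where 'a = real]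
    unfolding Suc by (simp add: divide_simps) (simp add: algebra_simps)
  finally show ?case .
qed

subsection \<open>Proof of the theorem\<close>

text \<open>Coefficientwise, t^1 carries the one-node tree, contributing y (y - 1) after
  multiplication by y - 1; higher powers are \<open>tree_interval_gf_Suc\<close>.\<close>

lemma tree_interval_gf_eq:
  "(fps_const catalytic - 1) * tree_interval_gf =
    fps_X * (fps_const catalytic * (fps_const catalytic - 1) +
      (fps_const catalytic ^ 2 * interval_gf - const_coeffs (at_one interval_gf)) * tree_interval_gf)"
proof (rule fps_ext)
  fix n
  have K0: "fps_nth tree_interval_gf 0 = 0" by (simp add: tree_interval_gf_nth)
  have K1: "fps_nth tree_interval_gf (Suc 0) = catalytic"
    by (simp add: tree_interval_gf_nth below_tree_pairs_1)
  have l: "fps_nth ((fps_const catalytic - 1) * h) k = (catalytic - 1) * fps_nth h k" for h k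
    by (simp add: left_diff_distrib)
  let ?H = "fps_const catalytic ^ 2 * interval_gf - const_coeffs (at_one interval_gf)"
  have H: "fps_nth ?H m = catalytic ^ 2 * fps_nth interval_gf m - [:poly (fps_nth interval_gf m) 1:]" for m
    by (simp add: const_coeffs_def at_one_def)
  have Y: "fps_const catalytic * (fps_const catalytic - 1) = fps_const (catalytic * (catalytic - 1))"
    by (simp add: right_diff_distrib)
  show "fps_nth ((fps_const catalytic - 1) * tree_interval_gf) n =
    fps_nth (fps_X * (fps_const catalytic * (fps_const catalytic - 1) + ?H * tree_interval_gf)) n"
  proof (cases n)
    case 0
    then show ?thesis by (simp add: K0)
  next
    case (Suc m)
    show ?thesis
    proof (cases "m = 0")
      case True
      then show ?thesis unfolding l Y Suc by (simp add: K0 K1 mult.commute)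
    next
      case False
      then have "fps_nth (fps_X * (fps_const (catalytic * (catalytic - 1)) + ?H * tree_interval_gf)) (Suc m) =
          fps_nth (?H * tree_interval_gf) m"
        by simp
      also have "\<dots> = (catalytic - 1) * fps_nth tree_interval_gf (Suc m)"
        using False unfolding fps_mult_nth H by (simp only: tree_interval_gf_Suc)
      finally show ?thesis unfolding l Y Suc by simp
    qed
  qed
qed

lemma at_one_interval_gf: "at_one interval_gf = bicubic_gf"
proof (rule catalytic_equation_at_one)
  let ?Y = "fps_const catalytic" and ?a = "const_coeffs (at_one interval_gf)"
  have "(?Y - 1) * (interval_gf - 1) = ((?Y - 1) * tree_interval_gf) * interval_gf"
    using interval_gf_eq by algebra
  also have "\<dots> = fps_X * (?Y * (?Y - 1) * interval_gf + (tree_interval_gf * interval_gf) * (?Y ^ 2 * interval_gf - ?a))"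
    unfolding tree_interval_gf_eq by algebra
  also have "tree_interval_gf * interval_gf = interval_gf - 1"
    using interval_gf_eq by algebra
  finally show "(?Y - 1) * (interval_gf - 1) = fps_X * catalytic_rhs interval_gf (at_one interval_gf)"
    unfolding catalytic_rhs_def .
qed

lemma card_dexter_intervals_eq: "real (card (dexter_intervals n)) = fps_nth bicubic_gf n"
  using arg_cong[OF at_one_interval_gf, of "\<lambda>f. fps_nth f n"]
  by (simp add: at_one_def poly_interval_gf card_dexter_intervals)

theorem theorem6p1:
  "card (dexter_intervals 0) = 1 \<and>
   (\<forall>n::nat. n \<ge> 1 \<longrightarrow>
      real (card (dexter_intervals n)) =
        3 * ((2 ^ (n - 1) * fact (2 * n)) / (fact n * fact (n + 2))))"
proof (intro conjI allI impI)
  show "card (dexter_intervals 0) = 1"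
    using card_dexter_intervals_eq[of 0] bicubic_gf_nth_0 by simp
next
  fix n :: nat assume "n \<ge> 1"
  then obtain m where "n = Suc m" by (cases n) auto
  then show "real (card (dexter_intervals n)) =
      3 * ((2 ^ (n - 1) * fact (2 * n)) / (fact n * fact (n + 2)))"
    using bicubic_gf_nth[of m] by (simp add: card_dexter_intervals_eq numeral_3_eq_3)
qed

end
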